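(* Let $(S,\sharp)$ be an involutive semigroup, let $U_+: S\to B(\mathcal{F})$ be a representation of $S$ by bounded operators on a Hilbert space $\mathcal{F}$, and let $H\geq 0$ be a positive $U_+$-Hankel operator on $\mathcal{F}$. Then $$\langle\xi,\eta\rangle_H := \langle\xi,H\eta\rangle_{\mathcal{F}}$$ defines a positive semidefinite hermitian form on $\mathcal{F}$. Let $\widehat{\mathcal{F}}$ be the associated Hilbert space and $q:\mathcal{F}\to\widehat{\mathcal{F}}$ the canonical map. Then there exists a uniquely determined $*$-representation $$\widehat U:(S,\sharp)\to B(\widehat{\mathcal{F}})\quad\text{satisfying}\quad\widehat U(s)\circ q = q\circ U_+(s)\quad\text{for all } s\in S.$$
   Context: An involutive semigroup $(S,\sharp)$ is a semigroup $S$ with a map $s\mapsto s^\sharp$ satisfying $(s^\sharp)^\sharp = s$ and $(st)^\sharp = t^\sharp s^\sharp$. A representation $U_+:S\to B(\mathcal{F})$ is a homomorphism into the multiplicative semigroup of bounded operators. An operator $A\in B(\mathcal{F})$ is a $U_+$-Hankel operator if $AU_+(s) = U_+(s^\sharp)^*A$ for all $s\in S$. A $*$-representation of $(S,\sharp)$ is a representation $\widehat U$ by bounded operators with $\widehat U(s^\sharp) = \widehat U(s)^*$ for all $s\in S$. The Hilbert space associated to the positive semidefinite form $\langle\cdot,\cdot\rangle_H$ is the completion of the quotient of $\mathcal{F}$ by the subspace $\{\xi:\langle\xi,\xi\rangle_H = 0\}$, and $q$ is the quotient map followed by the inclusion. Scalar products are antilinear in the first argument. *)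

theory Defs
  imports "HOL-Analysis.Analysis" "HOL-Algebra.Module" "HOL-Algebra.AbelCoset"
begin

section \<open>Complex Hilbert spaces\<close>

text \<open>Hilbert spaces are carrier-based, because the Hilbert space associated to a form depends on
  the form and hence cannot be a type. The underlying vector spaces are modules in the sense of
  HOL-Algebra over the field of complex numbers; the record fields \<open>mult\<close> and \<open>one\<close>, which the
  module record inherits from rings, play no role.\<close>

definition complex_ring :: "complex ring" where
  "complex_ring =
     \<lparr>carrier = UNIV, monoid.mult = (*), one = 1, ring.zero = 0, add = (+)\<rparr>"

record 'a hspace = "(complex, 'a) module" +
  cinner :: "'a \<Rightarrow> 'a \<Rightarrow> complex"

text \<open>Scalar products are antilinear in the first and linear in the second argument.\<close>

definition psd_hermitian_form ::
    "(complex, 'a, 'b) module_scheme \<Rightarrow> ('a \<Rightarrow> 'a \<Rightarrow> complex) \<Rightarrow> bool" where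
  "psd_hermitian_form V h \<longleftrightarrow>
     (\<forall>x\<in>carrier V. \<forall>y\<in>carrier V. \<forall>z\<in>carrier V. h x (y \<oplus>\<^bsub>V\<^esub> z) = h x y + h x z) \<and>
     (\<forall>x\<in>carrier V. \<forall>y\<in>carrier V. \<forall>c. h x (c \<odot>\<^bsub>V\<^esub> y) = c * h x y) \<and>
     (\<forall>x\<in>carrier V. \<forall>y\<in>carrier V. h y x = cnj (h x y)) \<and>
     (\<forall>x\<in>carrier V. h x x \<in> \<real>\<^sub>\<ge>\<^sub>0)"

definition complex_inner_space :: "'a hspace \<Rightarrow> bool" where
  "complex_inner_space V \<longleftrightarrow>
     Module.module complex_ring V \<and>
     psd_hermitian_form V (cinner V) \<and>
     (\<forall>x\<in>carrier V. cinner V x x = 0 \<longrightarrow> x = \<zero>\<^bsub>V\<^esub>)"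

definition cnorm :: "'a hspace \<Rightarrow> 'a \<Rightarrow> real" where
  "cnorm V x = sqrt (Re (cinner V x x))"

text \<open>The locale \<open>Metric_space\<close> requires symmetry and nonnegativity of the distance also outside
  the carrier, hence the case distinction.\<close>

definition cdist :: "'a hspace \<Rightarrow> 'a \<Rightarrow> 'a \<Rightarrow> real" where
  "cdist V x y =
     (if x \<in> carrier V \<and> y \<in> carrier V then cnorm V (x \<ominus>\<^bsub>V\<^esub> y) else 0)"

definition complex_hilbert_space :: "'a hspace \<Rightarrow> bool" where
  "complex_hilbert_space V \<longleftrightarrow>
     complex_inner_space V \<and> Metric_space.mcomplete (carrier V) (cdist V)"

section \<open>Bounded operators\<close>

text \<open>Operators are extensional functions on the carrier, so that equality of operators is equality
  of functions; accordingly products of operators are formed with \<open>compose\<close>.\<close>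

definition bounded_operators :: "'a hspace \<Rightarrow> ('a \<Rightarrow> 'a) set" where
  "bounded_operators V =
     {A \<in> carrier V \<rightarrow>\<^sub>E carrier V.
        (\<forall>x\<in>carrier V. \<forall>y\<in>carrier V. A (x \<oplus>\<^bsub>V\<^esub> y) = A x \<oplus>\<^bsub>V\<^esub> A y) \<and>
        (\<forall>c. \<forall>x\<in>carrier V. A (c \<odot>\<^bsub>V\<^esub> x) = c \<odot>\<^bsub>V\<^esub> A x) \<and>
        (\<exists>C. \<forall>x\<in>carrier V. cnorm V (A x) \<le> C * cnorm V x)}"

definition adjoint_operator :: "'a hspace \<Rightarrow> ('a \<Rightarrow> 'a) \<Rightarrow> ('a \<Rightarrow> 'a)" where
  "adjoint_operator V A =
     (THE B. B \<in> bounded_operators V \<and>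
        (\<forall>x\<in>carrier V. \<forall>y\<in>carrier V. cinner V (A x) y = cinner V x (B y)))"

definition positive_operator :: "'a hspace \<Rightarrow> ('a \<Rightarrow> 'a) \<Rightarrow> bool" where
  "positive_operator V A \<longleftrightarrow>
     A \<in> bounded_operators V \<and> (\<forall>x\<in>carrier V. cinner V x (A x) \<in> \<real>\<^sub>\<ge>\<^sub>0)"

section \<open>The Hilbert space associated to a positive semidefinite form\<close>

definition null_space ::
    "(complex, 'a, 'b) module_scheme \<Rightarrow> ('a \<Rightarrow> 'a \<Rightarrow> complex) \<Rightarrow> 'a set" where
  "null_space V h = {x \<in> carrier V. h x x = 0}"

definition quotient_space ::
    "(complex, 'a, 'b) module_scheme \<Rightarrow> ('a \<Rightarrow> 'a \<Rightarrow> complex) \<Rightarrow> 'a set hspace" where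
  "quotient_space V h =
     \<lparr>carrier = a_rcosets\<^bsub>V\<^esub> (null_space V h),
      monoid.mult = undefined,
      one = undefined,
      ring.zero = null_space V h,
      add = (\<lambda>A B. A <+>\<^bsub>V\<^esub> B),
      smult = (\<lambda>c A. \<Union>a\<in>A. null_space V h +>\<^bsub>V\<^esub> (c \<odot>\<^bsub>V\<^esub> a)),
      cinner = (\<lambda>A B. THE z. \<exists>a\<in>A. \<exists>b\<in>B. z = h a b)\<rparr>"

text \<open>The completion consists of the Cauchy sequences modulo the relation that the distance tends to
  \<open>0\<close>.\<close>

definition cauchy_rel :: "'a hspace \<Rightarrow> ((nat \<Rightarrow> 'a) \<times> (nat \<Rightarrow> 'a)) set" where
  "cauchy_rel V =
     {(\<sigma>, \<tau>). Metric_space.MCauchy (carrier V) (cdist V) \<sigma> \<and>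
        Metric_space.MCauchy (carrier V) (cdist V) \<tau> \<and>
        (\<lambda>n. cdist V (\<sigma> n) (\<tau> n)) \<longlonglongrightarrow> 0}"

definition completion_space :: "'a hspace \<Rightarrow> (nat \<Rightarrow> 'a) set hspace" where
  "completion_space V =
     \<lparr>carrier = Collect (Metric_space.MCauchy (carrier V) (cdist V)) // cauchy_rel V,
      monoid.mult = undefined,
      one = undefined,
      ring.zero = cauchy_rel V `` {\<lambda>n. \<zero>\<^bsub>V\<^esub>},
      add = (\<lambda>X Y. \<Union>\<sigma>\<in>X. \<Union>\<tau>\<in>Y. cauchy_rel V `` {\<lambda>n. \<sigma> n \<oplus>\<^bsub>V\<^esub> \<tau> n}),
      smult = (\<lambda>c X. \<Union>\<sigma>\<in>X. cauchy_rel V `` {\<lambda>n. c \<odot>\<^bsub>V\<^esub> \<sigma> n}),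
      cinner = (\<lambda>X Y. THE z. \<exists>\<sigma>\<in>X. \<exists>\<tau>\<in>Y. (\<lambda>n. cinner V (\<sigma> n) (\<tau> n)) \<longlonglongrightarrow> z)\<rparr>"

definition associated_space ::
    "(complex, 'a, 'b) module_scheme \<Rightarrow> ('a \<Rightarrow> 'a \<Rightarrow> complex) \<Rightarrow> (nat \<Rightarrow> 'a set) set hspace" where
  "associated_space V h = completion_space (quotient_space V h)"

definition associated_map ::
    "(complex, 'a, 'b) module_scheme \<Rightarrow> ('a \<Rightarrow> 'a \<Rightarrow> complex) \<Rightarrow> 'a \<Rightarrow> (nat \<Rightarrow> 'a set) set" where
  "associated_map V h =
     (\<lambda>x\<in>carrier V. cauchy_rel (quotient_space V h) `` {\<lambda>n. null_space V h +>\<^bsub>V\<^esub> x})"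

section \<open>Representations of involutive semigroups and Hankel operators\<close>

definition involutive_semigroup :: "('s::semigroup_mult \<Rightarrow> 's) \<Rightarrow> bool" where
  "involutive_semigroup sharp \<longleftrightarrow>
     (\<forall>s. sharp (sharp s) = s) \<and> (\<forall>s t. sharp (s * t) = sharp t * sharp s)"

definition semigroup_representation :: "'a hspace \<Rightarrow> ('s::semigroup_mult \<Rightarrow> 'a \<Rightarrow> 'a) \<Rightarrow> bool" where
  "semigroup_representation V U \<longleftrightarrow>
     (\<forall>s. U s \<in> bounded_operators V) \<and>
     (\<forall>s t. U (s * t) = compose (carrier V) (U s) (U t))"

definition star_representation ::
    "('s::semigroup_mult \<Rightarrow> 's) \<Rightarrow> 'a hspace \<Rightarrow> ('s \<Rightarrow> 'a \<Rightarrow> 'a) \<Rightarrow> bool" where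
  "star_representation sharp V U \<longleftrightarrow>
     semigroup_representation V U \<and> (\<forall>s. U (sharp s) = adjoint_operator V (U s))"

definition hankel_operator ::
    "('s::semigroup_mult \<Rightarrow> 's) \<Rightarrow> 'a hspace \<Rightarrow> ('s \<Rightarrow> 'a \<Rightarrow> 'a) \<Rightarrow> ('a \<Rightarrow> 'a) \<Rightarrow> bool" where
  "hankel_operator sharp V U A \<longleftrightarrow>
     A \<in> bounded_operators V \<and>
     (\<forall>s. compose (carrier V) A (U s) =
          compose (carrier V) (adjoint_operator V (U (sharp s))) A)"

definition hankel_form :: "'a hspace \<Rightarrow> ('a \<Rightarrow> 'a) \<Rightarrow> 'a \<Rightarrow> 'a \<Rightarrow> complex" where
  "hankel_form V H x y = cinner V x (H y)"

end

theory Submission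
  imports Defs
begin

text \<open>By the Hankel condition \<open>H U(s) = U(s\<^sup>\<sharp>)\<^sup>* H\<close>, the operators \<open>U(s)\<close> and \<open>U(s\<^sup>\<sharp>)\<close> are formal adjoints of
  each other for the form \<open>h\<close> defined by \<open>H\<close>. Hence \<open>T = U(s\<^sup>\<sharp> s)\<close> is \<open>h\<close>-symmetric, so the
  sequence \<open>\<parallel>T\<^sup>n x\<parallel>\<close> of seminorms is log-convex by the Cauchy-Schwarz inequality. It grows at
  most like \<open>C\<^sup>n\<close>, where \<open>C\<close> bounds \<open>T\<close> on the original Hilbert space, and therefore
  \<open>\<parallel>T x\<parallel> \<le> C \<parallel>x\<parallel>\<close> in the seminorm. Then \<open>\<parallel>U(s) x\<parallel>\<^sup>2 = h x (T x) \<le> C \<parallel>x\<parallel>\<^sup>2\<close>, so \<open>U(s)\<close> extends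
  uniquely to the completion, and all identities extend by density.

  Both the quotient by the null space and the completion are images of a space with a positive
  semidefinite form (for the completion, the Cauchy sequences with the limit of the forms) modulo
  vectors at distance \<open>0\<close>.\<close>

section \<open>Positive semidefinite forms\<close>

text \<open>A bound for \<open>U s\<close> in the norm of \<open>F\<close> says nothing directly
  about the seminorm of \<open>h\<close>: \<open>H\<close> may be far from invertible, so in general
  the two compare in one direction only, \<open>h.nrm x\<close> being at most a fixed multiple of
  \<open>F.nrm x\<close>. This comparison puts a constant in front of the powers
  \<open>C ^ n\<close>. It disappears because a log-convex sequence is controlled by its exponential
  growth rate alone; this is why all powers of an operator are estimated, and why
  \<open>U s\<close>, which need not be symmetric, enters through the fixed point
  \<open>sharp s * s\<close> of \<open>sharp\<close>.

  Adjoints are given by a description operator and carry information only once existence is known.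
  On \<open>F\<close> existence comes from the Riesz theorem; this is where completeness of
  \<open>F\<close> makes the Hankel condition usable. On the completion the adjoint of each extended
  operator is exhibited, so uniqueness suffices there.

  \<open>F\<close> carries two forms, its scalar product and \<open>h\<close>, and the second may be
  degenerate. Hence seminorms, limits and Cauchy sequences are developed for a form that is a
  parameter separate from the space.\<close>

lemma complex_ring_simps [simp]:
  "carrier complex_ring = UNIV" "x \<otimes>\<^bsub>complex_ring\<^esub> y = x * y" "\<one>\<^bsub>complex_ring\<^esub> = 1"
  "\<zero>\<^bsub>complex_ring\<^esub> = 0" "x \<oplus>\<^bsub>complex_ring\<^esub> y = x + y"
  by (simp_all add: complex_ring_def)

lemma cring_complex_ring: "cring complex_ring"
proof (rule cringI)
  show "abelian_group complex_ring"
    by (rule abelian_groupI) (auto simp: algebra_simps intro: exI[of _ "- _"])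
  show "comm_monoid complex_ring"
    by (rule comm_monoidI) (auto simp: algebra_simps)
qed (auto simp: algebra_simps)

locale psd_space = module complex_ring V for V :: "(complex, 'a, 'b) module_scheme" (structure) +
  fixes h :: "'a \<Rightarrow> 'a \<Rightarrow> complex"
  assumes psd: "psd_hermitian_form V h"
begin

definition nrm :: "'a \<Rightarrow> real" where
  "nrm x = sqrt (Re (h x x))"

text \<open>Both relations divided out later are instances: congruence modulo
  \<open>null_space V h\<close>, and \<open>cauchy_rel\<close> when the space consists of Cauchy
  sequences.\<close>

definition equivalence :: "('a \<times> 'a) set" where
  "equivalence = {(x, y). x \<in> carrier V \<and> y \<in> carrier V \<and> nrm (x \<ominus> y) = 0}"

text \<open>Stated through the seminorm, since a degenerate form gives no
  \<open>Metric_space\<close> on the carrier. Limits become unique only in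
  \<open>inner_space\<close>.\<close>

definition conv :: "(nat \<Rightarrow> 'a) \<Rightarrow> 'a \<Rightarrow> bool" where
  "conv \<sigma> x \<longleftrightarrow> (\<forall>n. \<sigma> n \<in> carrier V) \<and> x \<in> carrier V \<and> (\<lambda>n. nrm (\<sigma> n \<ominus> x)) \<longlonglongrightarrow> 0"

definition cauchy :: "(nat \<Rightarrow> 'a) \<Rightarrow> bool" where
  "cauchy \<sigma> \<longleftrightarrow> (\<forall>n. \<sigma> n \<in> carrier V) \<and>
     (\<forall>\<epsilon>>0. \<exists>N. \<forall>m\<ge>N. \<forall>n\<ge>N. nrm (\<sigma> m \<ominus> \<sigma> n) < \<epsilon>)"

lemma smult_in [simp, intro]: "x \<in> carrier V \<Longrightarrow> c \<odot> x \<in> carrier V"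
  by simp

lemma smult_add: "x \<in> carrier V \<Longrightarrow> y \<in> carrier V \<Longrightarrow> c \<odot> (x \<oplus> y) = c \<odot> x \<oplus> c \<odot> y"
  using smult_r_distr by simp

lemma add_smult: "x \<in> carrier V \<Longrightarrow> (c + d) \<odot> x = c \<odot> x \<oplus> d \<odot> x"
  using smult_l_distr by simp

lemma smult_smult: "x \<in> carrier V \<Longrightarrow> c \<odot> (d \<odot> x) = (c * d) \<odot> x"
  using smult_assoc1[of c d x] by simp

lemma zero_smult [simp]: "x \<in> carrier V \<Longrightarrow> 0 \<odot> x = \<zero>"
  using smult_l_null by simp

lemma smult_1 [simp]: "x \<in> carrier V \<Longrightarrow> 1 \<odot> x = x"
  using smult_one by simp

lemma diff_add_cancel [simp]: "x \<in> carrier V \<Longrightarrow> y \<in> carrier V \<Longrightarrow> (x \<ominus> y) \<oplus> y = x"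
  by (simp add: a_minus_def M.a_assoc M.l_neg)

lemma diff_self [simp]: "x \<in> carrier V \<Longrightarrow> x \<ominus> x = \<zero>"
  by (simp add: a_minus_def M.r_neg)

lemma diff_zero_right [simp]: "x \<in> carrier V \<Longrightarrow> x \<ominus> \<zero> = x"
  using diff_add_cancel[of x \<zero>] by (metis M.minus_closed M.r_zero M.zero_closed)

lemma diff_zero_iff: "x \<in> carrier V \<Longrightarrow> y \<in> carrier V \<Longrightarrow> x \<ominus> y = \<zero> \<longleftrightarrow> x = y"
  by (metis M.l_zero diff_add_cancel diff_self)

lemma form_add_right:
  "x \<in> carrier V \<Longrightarrow> y \<in> carrier V \<Longrightarrow> z \<in> carrier V \<Longrightarrow> h x (y \<oplus> z) = h x y + h x z"
  using psd unfolding psd_hermitian_form_def by blast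

lemma form_smult_right: "x \<in> carrier V \<Longrightarrow> y \<in> carrier V \<Longrightarrow> h x (c \<odot> y) = c * h x y"
  using psd unfolding psd_hermitian_form_def by blast

lemma form_herm: "x \<in> carrier V \<Longrightarrow> y \<in> carrier V \<Longrightarrow> h y x = cnj (h x y)"
  using psd unfolding psd_hermitian_form_def by blast

lemma form_self: "x \<in> carrier V \<Longrightarrow> h x x \<in> \<real>\<^sub>\<ge>\<^sub>0"
  using psd unfolding psd_hermitian_form_def by blast

lemma form_add_left:
  "x \<in> carrier V \<Longrightarrow> y \<in> carrier V \<Longrightarrow> z \<in> carrier V \<Longrightarrow> h (x \<oplus> y) z = h x z + h y z"
  by (simp add: form_herm[of z] form_add_right)

lemma form_smult_left: "x \<in> carrier V \<Longrightarrow> y \<in> carrier V \<Longrightarrow> h (c \<odot> x) y = cnj c * h x y"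
  by (simp add: form_herm[of y] form_smult_right)

lemma form_zero_right [simp]: "x \<in> carrier V \<Longrightarrow> h x \<zero> = 0"
  using form_smult_right[of x \<zero> 0] by simp

lemma form_zero_left [simp]: "x \<in> carrier V \<Longrightarrow> h \<zero> x = 0"
  using form_smult_left[of \<zero> x 0] by simp

lemma form_diff_right:
  assumes "x \<in> carrier V" "y \<in> carrier V" "z \<in> carrier V"
  shows "h x (y \<ominus> z) = h x y - h x z"
proof -
  have "h x ((y \<ominus> z) \<oplus> z) = h x (y \<ominus> z) + h x z"
    using assms by (intro form_add_right) auto
  then show ?thesis using assms by simp
qed

lemma form_diff_left:
  "x \<in> carrier V \<Longrightarrow> y \<in> carrier V \<Longrightarrow> z \<in> carrier V \<Longrightarrow> h (x \<ominus> y) z = h x z - h y z"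
  by (simp add: form_herm[of z] form_diff_right)

lemmas form_simps = form_add_right form_add_left form_smult_right form_smult_left
  form_diff_right form_diff_left

section \<open>The seminorm of a form and the Cauchy-Schwarz inequality\<close>

lemma nrm_nonneg [simp]: "x \<in> carrier V \<Longrightarrow> 0 \<le> nrm x"
  using form_self[of x] by (auto simp: nrm_def complex_nonneg_Reals_iff)

lemma nrm_sq: "x \<in> carrier V \<Longrightarrow> (nrm x)\<^sup>2 = Re (h x x)"
  using form_self[of x] by (auto simp: nrm_def complex_nonneg_Reals_iff)

lemma form_nrm: "x \<in> carrier V \<Longrightarrow> h x x = of_real ((nrm x)\<^sup>2)"
  using form_self[of x] nrm_sq[of x] by (auto simp: complex_nonneg_Reals_iff complex_eq_iff)

lemma nrm_zero [simp]: "nrm \<zero> = 0"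
  by (simp add: nrm_def)

lemma nrm_eq_0_iff: "x \<in> carrier V \<Longrightarrow> nrm x = 0 \<longleftrightarrow> h x x = 0"
  by (auto simp: form_nrm)

lemma nrm_smult: "x \<in> carrier V \<Longrightarrow> nrm (c \<odot> x) = cmod c * nrm x"
proof (rule power2_eq_imp_eq)
  assume x: "x \<in> carrier V"
  have "h (c \<odot> x) (c \<odot> x) = c * cnj c * of_real ((nrm x)\<^sup>2)"
    using x by (simp add: form_smult_right form_smult_left form_nrm[of x])
  then show "(nrm (c \<odot> x))\<^sup>2 = (cmod c * nrm x)\<^sup>2"
    using x by (simp add: nrm_sq[of "c \<odot> x"] complex_norm_square[symmetric] power_mult_distrib)
qed auto

text \<open>The free coefficient \<open>c\<close> lets one expansion serve Cauchy-Schwarz, the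
  triangle inequality, the parallelogram law and the variational argument for the Riesz
  theorem.\<close>

lemma nrm_add_smult_sq:
  assumes "x \<in> carrier V" "y \<in> carrier V"
  shows "(nrm (x \<oplus> c \<odot> y))\<^sup>2 = (nrm x)\<^sup>2 + 2 * Re (c * h x y) + (cmod c)\<^sup>2 * (nrm y)\<^sup>2"
proof -
  have "h (x \<oplus> c \<odot> y) (x \<oplus> c \<odot> y) =
      of_real ((nrm x)\<^sup>2) + (c * h x y + cnj (c * h x y)) + c * cnj c * of_real ((nrm y)\<^sup>2)"
    using assms by (simp add: form_simps form_herm[of x y] form_nrm[of x] form_nrm[of y] algebra_simps)
  then show ?thesis
    using assms by (simp add: nrm_sq[of "x \<oplus> c \<odot> y"] complex_norm_square[symmetric])
qed

lemma cauchy_schwarz: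
  assumes x: "x \<in> carrier V" and y: "y \<in> carrier V"
  shows "cmod (h x y) \<le> nrm x * nrm y"
proof -
  define a where "a = (cmod (h x y))\<^sup>2"
  \<comment> \<open>The squared seminorm of \<open>x \<oplus> s \<odot> y\<close>, where
    \<open>s\<close> is \<open>- t\<close> times the conjugate of \<open>h x y\<close>. This phase
    makes the mixed term real, leaving a quadratic polynomial in the real variable
    \<open>t\<close>.\<close>
  have *: "0 \<le> (nrm x)\<^sup>2 - 2 * t * a + t\<^sup>2 * a * (nrm y)\<^sup>2" for t
  proof -
    define s where "s = - (of_real t * cnj (h x y))"
    have Re_s: "Re (s * h x y) = - t * a"
      unfolding a_def cmod_power2 s_def by (simp add: power2_eq_square algebra_simps)
    have cmod_s: "(cmod s)\<^sup>2 = t\<^sup>2 * a"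
      by (simp add: s_def a_def norm_mult power_mult_distrib)
    have "0 \<le> (nrm x)\<^sup>2 + 2 * Re (s * h x y) + (cmod s)\<^sup>2 * (nrm y)\<^sup>2"
      using nrm_add_smult_sq[OF x y, of s] zero_le_power2 by metis
    then show ?thesis unfolding Re_s cmod_s by simp
  qed
  have "a \<le> (nrm x)\<^sup>2 * (nrm y)\<^sup>2"
  proof (cases "nrm y = 0")
    case True
    have "a = 0"
    proof (rule ccontr)
      assume "a \<noteq> 0"
      \<comment> \<open>When \<open>nrm y = 0\<close> the polynomial is affine in \<open>t\<close>;
        at this point its value would be -1.\<close>
      with *[of "((nrm x)\<^sup>2 + 1) / (2 * a)"] True show False by simp
    qed
    with True show ?thesis by simp
  next
    case False
    define N where "N = (nrm y)\<^sup>2"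
    have N: "N > 0" using False by (simp add: N_def)
    \<comment> \<open>The choice \<open>t = 1 / N\<close> minimises the quadratic.\<close>
    have "0 \<le> (nrm x)\<^sup>2 - 2 * (1 / N) * a + (1 / N)\<^sup>2 * a * N"
      using * unfolding N_def .
    also have "\<dots> = (nrm x)\<^sup>2 - a / N"
      using N by (simp add: power2_eq_square)
    finally show ?thesis
      using N unfolding N_def[symmetric] by (simp add: pos_divide_le_eq)
  qed
  then have "(cmod (h x y))\<^sup>2 \<le> (nrm x * nrm y)\<^sup>2"
    unfolding a_def power_mult_distrib .
  then show ?thesis
    by (rule power2_le_imp_le) (intro mult_nonneg_nonneg nrm_nonneg x y)
qed

lemma nrm_triangle:
  assumes x: "x \<in> carrier V" and y: "y \<in> carrier V"
  shows "nrm (x \<oplus> y) \<le> nrm x + nrm y"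
proof (rule power2_le_imp_le)
  have "Re (h x y) \<le> nrm x * nrm y"
    using cauchy_schwarz[OF x y] complex_Re_le_cmod order_trans by blast
  then show "(nrm (x \<oplus> y))\<^sup>2 \<le> (nrm x + nrm y)\<^sup>2"
    using nrm_add_smult_sq[OF x y, of 1] x y by (simp add: power2_sum)
qed (use x y in auto)

lemma nrm_diff_sq:
  assumes "x \<in> carrier V" "y \<in> carrier V"
  shows "(nrm (x \<ominus> y))\<^sup>2 = (nrm x)\<^sup>2 - 2 * Re (h x y) + (nrm y)\<^sup>2"
  using assms form_herm[of x y] by (simp add: nrm_sq form_simps)

lemma nrm_diff_commute: "x \<in> carrier V \<Longrightarrow> y \<in> carrier V \<Longrightarrow> nrm (x \<ominus> y) = nrm (y \<ominus> x)"
  by (rule power2_eq_imp_eq) (auto simp: nrm_sq form_simps)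

lemma dist_triangle:
  assumes "x \<in> carrier V" "y \<in> carrier V" "z \<in> carrier V"
  shows "nrm (x \<ominus> z) \<le> nrm (x \<ominus> y) + nrm (y \<ominus> z)"
proof -
  have "x \<ominus> z = (x \<ominus> y) \<oplus> (y \<ominus> z)"
    using assms by (simp add: a_minus_def M.a_assoc M.r_neg1)
  then show ?thesis using nrm_triangle assms by simp
qed

lemma nrm_diff_ineq:
  assumes "x \<in> carrier V" "y \<in> carrier V"
  shows "\<bar>nrm x - nrm y\<bar> \<le> nrm (x \<ominus> y)"
  using nrm_triangle[of "x \<ominus> y" y] nrm_triangle[of "y \<ominus> x" x] nrm_diff_commute[of x y] assms
  by simp

lemma nrm_diff_add_diff:
  assumes "x \<in> carrier V" "y \<in> carrier V" "x' \<in> carrier V" "y' \<in> carrier V"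
  shows "nrm ((x \<oplus> y) \<ominus> (x' \<oplus> y')) \<le> nrm (x \<ominus> x') + nrm (y \<ominus> y')"
proof -
  have "(x \<oplus> y) \<ominus> (x' \<oplus> y') = (x \<ominus> x') \<oplus> (y \<ominus> y')"
    using assms by (simp add: a_minus_def M.minus_add M.a_ac)
  then show ?thesis using nrm_triangle assms by simp
qed

lemma nrm_smult_diff:
  assumes "x \<in> carrier V" "y \<in> carrier V"
  shows "nrm (c \<odot> x \<ominus> c \<odot> y) = cmod c * nrm (x \<ominus> y)"
proof -
  have "c \<odot> (x \<ominus> y) \<oplus> c \<odot> y = c \<odot> x"
    using assms smult_add[of "x \<ominus> y" y c] by simp
  then have "c \<odot> x \<ominus> c \<odot> y = c \<odot> (x \<ominus> y)"
    using assms by (metis M.minus_closed M.a_assoc M.r_neg M.r_zero M.a_inv_closed a_minus_def smult_in)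
  then show ?thesis using assms by (simp add: nrm_smult)
qed

text \<open>One argument is changed at a time and Cauchy-Schwarz is applied to each difference.
  Well-definedness of the form on classes, its continuity and its convergence along Cauchy sequences
  all rest on this estimate.\<close>

lemma form_diff_bound:
  assumes "x \<in> carrier V" "y \<in> carrier V" "x' \<in> carrier V" "y' \<in> carrier V"
  shows "cmod (h x y - h x' y') \<le> nrm (x \<ominus> x') * nrm y + nrm x' * nrm (y \<ominus> y')"
proof -
  have "h x y - h x' y' = h (x \<ominus> x') y + h x' (y \<ominus> y')"
    using assms by (simp add: form_simps)
  then show ?thesis
    using cauchy_schwarz[of "x \<ominus> x'" y] cauchy_schwarz[of x' "y \<ominus> y'"] assms
      norm_triangle_ineq[of "h (x \<ominus> x') y" "h x' (y \<ominus> y')"]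
    by (simp del: norm_triangle_ineq)
qed

section \<open>Vectors at distance zero, and operations on their classes\<close>

lemma equivalence_refl: "x \<in> carrier V \<Longrightarrow> (x, x) \<in> equivalence"
  by (simp add: equivalence_def)

lemma equiv_equivalence: "equiv (carrier V) equivalence"
proof (rule equivI)
  show "refl_on (carrier V) equivalence"
    by (auto simp: refl_on_def equivalence_def)
  show "sym equivalence"
    by (auto simp: sym_def equivalence_def nrm_diff_commute)
  show "trans equivalence"
  proof (rule transI)
    fix x y z assume "(x, y) \<in> equivalence" "(y, z) \<in> equivalence"
    then show "(x, z) \<in> equivalence"
      using dist_triangle[of x y z] by (auto simp: equivalence_def intro: order_antisym)
  qed
qed (auto simp: equivalence_def)

lemma equivalence_add:
  assumes "(x, x') \<in> equivalence" "(y, y') \<in> equivalence"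
  shows "(x \<oplus> y, x' \<oplus> y') \<in> equivalence"
  using assms nrm_diff_add_diff[of x y x' y']
  by (auto simp: equivalence_def intro: order_antisym)

lemma equivalence_smult: "(x, x') \<in> equivalence \<Longrightarrow> (c \<odot> x, c \<odot> x') \<in> equivalence"
  by (auto simp: equivalence_def nrm_smult_diff)

lemma form_cong:
  assumes "(x, x') \<in> equivalence" "(y, y') \<in> equivalence"
  shows "h x y = h x' y'"
  using assms form_diff_bound[of x y x' y'] by (auto simp: equivalence_def)

text \<open>All sets in the union coincide because addition respects the relation, and reflexivity
  provides at least one of them.\<close>

lemma class_add:
  assumes "x \<in> carrier V" "y \<in> carrier V"
  shows "(\<Union>a\<in>equivalence `` {x}. \<Union>b\<in>equivalence `` {y}. equivalence `` {a \<oplus> b}) =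
    equivalence `` {x \<oplus> y}"
proof -
  have "equivalence `` {a \<oplus> b} = equivalence `` {x \<oplus> y}"
    if "a \<in> equivalence `` {x}" "b \<in> equivalence `` {y}" for a b
    using equiv_class_eq[OF equiv_equivalence equivalence_add] that by blast
  then show ?thesis using equivalence_refl assms by blast
qed

lemma class_smult:
  assumes "x \<in> carrier V"
  shows "(\<Union>a\<in>equivalence `` {x}. equivalence `` {c \<odot> a}) = equivalence `` {c \<odot> x}"
proof -
  have "equivalence `` {c \<odot> a} = equivalence `` {c \<odot> x}" if "a \<in> equivalence `` {x}" for a
    using equiv_class_eq[OF equiv_equivalence equivalence_smult] that by blast
  then show ?thesis using equivalence_refl assms by blast
qed

lemma class_form:
  assumes "x \<in> carrier V" "y \<in> carrier V"
  shows "(THE z. \<exists>a\<in>equivalence `` {x}. \<exists>b\<in>equivalence `` {y}. z = h a b) = h x y"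
proof (rule the_equality)
  show "\<exists>a\<in>equivalence `` {x}. \<exists>b\<in>equivalence `` {y}. h x y = h a b"
    using equivalence_refl assms by blast
qed (metis form_cong Image_singleton_iff)

section \<open>Convergence and Cauchy sequences for the seminorm\<close>

lemma convD: "conv \<sigma> x \<Longrightarrow> \<sigma> n \<in> carrier V" "conv \<sigma> x \<Longrightarrow> x \<in> carrier V"
  by (auto simp: conv_def)

lemma conv_dist: "conv \<sigma> x \<Longrightarrow> (\<lambda>n. nrm (\<sigma> n \<ominus> x)) \<longlonglongrightarrow> 0"
  by (simp add: conv_def)

lemma cauchyD: "cauchy \<sigma> \<Longrightarrow> \<sigma> n \<in> carrier V"
  by (auto simp: cauchy_def)

lemma convI_bound:
  assumes "\<And>n. \<sigma> n \<in> carrier V" "x \<in> carrier V" "\<And>n. nrm (\<sigma> n \<ominus> x) \<le> f n" "f \<longlonglongrightarrow> 0"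
  shows "conv \<sigma> x"
  unfolding conv_def
  using assms by (auto intro!: tendsto_sandwich[of "\<lambda>_. 0" "\<lambda>n. nrm (\<sigma> n \<ominus> x)" _ f])

lemma conv_const: "x \<in> carrier V \<Longrightarrow> conv (\<lambda>n. x) x"
  by (simp add: conv_def)

lemma conv_add:
  assumes "conv \<sigma> x" "conv \<tau> y"
  shows "conv (\<lambda>n. \<sigma> n \<oplus> \<tau> n) (x \<oplus> y)"
proof (rule convI_bound)
  show "(\<lambda>n. nrm (\<sigma> n \<ominus> x) + nrm (\<tau> n \<ominus> y)) \<longlonglongrightarrow> 0"
    using assms tendsto_add[of _ 0 _ _ 0] by (fastforce simp: conv_def)
qed (use assms in \<open>auto simp: conv_def intro: nrm_diff_add_diff\<close>)

lemma conv_smult: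
  assumes "conv \<sigma> x"
  shows "conv (\<lambda>n. c \<odot> \<sigma> n) (c \<odot> x)"
proof (rule convI_bound)
  show "(\<lambda>n. cmod c * nrm (\<sigma> n \<ominus> x)) \<longlonglongrightarrow> 0"
    using assms tendsto_mult_right_zero by (fastforce simp: conv_def)
qed (use assms in \<open>auto simp: conv_def nrm_smult_diff\<close>)

lemma conv_nrm:
  assumes "conv \<sigma> x"
  shows "(\<lambda>n. nrm (\<sigma> n)) \<longlonglongrightarrow> nrm x"
proof -
  have "(\<lambda>n. nrm (\<sigma> n) - nrm x) \<longlonglongrightarrow> 0"
    by (rule Lim_null_comparison[of _ "\<lambda>n. nrm (\<sigma> n \<ominus> x)"])
       (use assms in \<open>auto simp: conv_def nrm_diff_ineq\<close>)
  then show ?thesis by (simp add: LIM_zero_iff)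
qed

lemma conv_form:
  assumes "conv \<sigma> x" "conv \<tau> y"
  shows "(\<lambda>n. h (\<sigma> n) (\<tau> n)) \<longlonglongrightarrow> h x y"
proof -
  note tendsto_add[OF tendsto_mult[OF conv_dist[OF assms(1)] conv_nrm[OF assms(2)]]
      tendsto_mult[OF tendsto_const[of "nrm x"] conv_dist[OF assms(2)]]]
  then have lim: "(\<lambda>n. nrm (\<sigma> n \<ominus> x) * nrm (\<tau> n) + nrm x * nrm (\<tau> n \<ominus> y)) \<longlonglongrightarrow> 0"
    by simp
  have "(\<lambda>n. h (\<sigma> n) (\<tau> n) - h x y) \<longlonglongrightarrow> 0"
    by (rule Lim_null_comparison[OF _ lim])
       (intro always_eventually allI form_diff_bound convD[OF assms(1)] convD[OF assms(2)])
  then show ?thesis by (simp add: LIM_zero_iff)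
qed

lemma conv_imp_cauchy:
  assumes "conv \<sigma> x"
  shows "cauchy \<sigma>"
  unfolding cauchy_def
proof (intro conjI allI impI)
  fix \<epsilon> :: real assume "\<epsilon> > 0"
  then have "\<forall>\<^sub>F n in sequentially. nrm (\<sigma> n \<ominus> x) < \<epsilon> / 2"
    by (intro order_tendstoD(2)[OF conv_dist[OF assms]]) simp
  then obtain N where N: "\<And>n. n \<ge> N \<Longrightarrow> nrm (\<sigma> n \<ominus> x) < \<epsilon> / 2"
    by (auto simp: eventually_sequentially)
  have "nrm (\<sigma> m \<ominus> \<sigma> n) < \<epsilon>" if "m \<ge> N" "n \<ge> N" for m n
    using N[OF that(1)] N[OF that(2)] dist_triangle[of "\<sigma> m" x "\<sigma> n"] convD[OF assms]
      nrm_diff_commute[of "\<sigma> n" x] by simp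
  then show "\<exists>N. \<forall>m\<ge>N. \<forall>n\<ge>N. nrm (\<sigma> m \<ominus> \<sigma> n) < \<epsilon>" by blast
qed (use assms in \<open>simp add: conv_def\<close>)

lemma cauchy_add:
  assumes "cauchy \<sigma>" "cauchy \<tau>"
  shows "cauchy (\<lambda>n. \<sigma> n \<oplus> \<tau> n)"
  unfolding cauchy_def
proof (intro conjI allI impI)
  fix \<epsilon> :: real assume "\<epsilon> > 0"
  then obtain N1 N2 where
    N1: "\<And>m n. m \<ge> N1 \<Longrightarrow> n \<ge> N1 \<Longrightarrow> nrm (\<sigma> m \<ominus> \<sigma> n) < \<epsilon> / 2" and
    N2: "\<And>m n. m \<ge> N2 \<Longrightarrow> n \<ge> N2 \<Longrightarrow> nrm (\<tau> m \<ominus> \<tau> n) < \<epsilon> / 2"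
    using assms half_gt_zero unfolding cauchy_def by meson
  have "nrm ((\<sigma> m \<oplus> \<tau> m) \<ominus> (\<sigma> n \<oplus> \<tau> n)) < \<epsilon>" if "m \<ge> max N1 N2" "n \<ge> max N1 N2" for m n
    using N1[of m n] N2[of m n] that nrm_diff_add_diff[of "\<sigma> m" "\<tau> m" "\<sigma> n" "\<tau> n"]
      assms cauchyD by fastforce
  then show "\<exists>N. \<forall>m\<ge>N. \<forall>n\<ge>N. nrm ((\<sigma> m \<oplus> \<tau> m) \<ominus> (\<sigma> n \<oplus> \<tau> n)) < \<epsilon>" by blast
qed (use assms in \<open>auto dest: cauchyD\<close>)

lemma cauchy_smult:
  assumes "cauchy \<sigma>"
  shows "cauchy (\<lambda>n. c \<odot> \<sigma> n)"
  unfolding cauchy_def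
proof (intro conjI allI impI)
  fix \<epsilon> :: real assume "\<epsilon> > 0"
  \<comment> \<open>The summand 1 keeps the divisor positive when \<open>c = 0\<close>.\<close>
  have c: "cmod c + 1 > 0" by (simp add: add_nonneg_pos)
  with \<open>\<epsilon> > 0\<close> have "\<epsilon> / (cmod c + 1) > 0" by simp
  then obtain N where N: "\<And>m n. m \<ge> N \<Longrightarrow> n \<ge> N \<Longrightarrow> nrm (\<sigma> m \<ominus> \<sigma> n) < \<epsilon> / (cmod c + 1)"
    using assms unfolding cauchy_def by meson
  have "nrm (c \<odot> \<sigma> m \<ominus> c \<odot> \<sigma> n) < \<epsilon>" if mn: "m \<ge> N" "n \<ge> N" for m n
  proof -
    have "cmod c * nrm (\<sigma> m \<ominus> \<sigma> n) \<le> (cmod c + 1) * nrm (\<sigma> m \<ominus> \<sigma> n)"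
      using cauchyD[OF assms] by (intro mult_right_mono) auto
    also have "\<dots> < \<epsilon>"
      using N[OF mn] c by (simp add: pos_less_divide_eq mult.commute)
    finally show ?thesis using cauchyD[OF assms] by (simp add: nrm_smult_diff)
  qed
  then show "\<exists>N. \<forall>m\<ge>N. \<forall>n\<ge>N. nrm (c \<odot> \<sigma> m \<ominus> c \<odot> \<sigma> n) < \<epsilon>" by blast
qed (use assms in \<open>auto dest: cauchyD\<close>)

lemma cauchy_nrm_convergent:
  assumes "cauchy \<sigma>"
  shows "convergent (\<lambda>n. nrm (\<sigma> n))"
proof -
  have "Cauchy (\<lambda>n. nrm (\<sigma> n))"
  proof (rule metric_CauchyI)
    fix \<epsilon> :: real assume "\<epsilon> > 0"
    then obtain N where N: "\<And>m n. m \<ge> N \<Longrightarrow> n \<ge> N \<Longrightarrow> nrm (\<sigma> m \<ominus> \<sigma> n) < \<epsilon>"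
      using assms unfolding cauchy_def by meson
    then show "\<exists>N. \<forall>m\<ge>N. \<forall>n\<ge>N. dist (nrm (\<sigma> m)) (nrm (\<sigma> n)) < \<epsilon>"
      using nrm_diff_ineq cauchyD[OF assms] unfolding dist_real_def by (meson order_le_less_trans)
  qed
  then show ?thesis by (simp add: Cauchy_convergent_iff)
qed

text \<open>Cauchy sequences have bounded seminorms, so \<open>form_diff_bound\<close> makes the
  values of the form a Cauchy sequence of complex numbers. The limit comes from completeness of the
  complex field, not of \<open>V\<close>.\<close>

lemma cauchy_form_convergent:
  assumes \<sigma>: "cauchy \<sigma>" and \<tau>: "cauchy \<tau>"
  shows "convergent (\<lambda>n. h (\<sigma> n) (\<tau> n))"
proof -
  obtain K where K: "K > 0" "\<And>n. nrm (\<sigma> n) \<le> K"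
    using convergent_imp_Bseq[OF cauchy_nrm_convergent[OF \<sigma>]] cauchyD[OF \<sigma>]
    by (auto simp: Bseq_def)
  obtain L where L: "L > 0" "\<And>n. nrm (\<tau> n) \<le> L"
    using convergent_imp_Bseq[OF cauchy_nrm_convergent[OF \<tau>]] cauchyD[OF \<tau>]
    by (auto simp: Bseq_def)
  have "Cauchy (\<lambda>n. h (\<sigma> n) (\<tau> n))"
  proof (rule metric_CauchyI)
    fix \<epsilon> :: real assume "\<epsilon> > 0"
    \<comment> \<open>\<open>L\<close> bounds the factor \<open>nrm (\<tau> m)\<close> of the first
      term in \<open>form_diff_bound\<close>, \<open>K\<close> the factor
      \<open>nrm (\<sigma> n)\<close> of the second; each term then contributes less than half of
      \<open>\<epsilon>\<close>.\<close>
    then have pos: "\<epsilon> / (2 * L) > 0" "\<epsilon> / (2 * K) > 0" using K L by auto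
    obtain N1 where N1: "\<And>m n. m \<ge> N1 \<Longrightarrow> n \<ge> N1 \<Longrightarrow> nrm (\<sigma> m \<ominus> \<sigma> n) < \<epsilon> / (2 * L)"
      using \<sigma> pos unfolding cauchy_def by meson
    obtain N2 where N2: "\<And>m n. m \<ge> N2 \<Longrightarrow> n \<ge> N2 \<Longrightarrow> nrm (\<tau> m \<ominus> \<tau> n) < \<epsilon> / (2 * K)"
      using \<tau> pos unfolding cauchy_def by meson
    have "dist (h (\<sigma> m) (\<tau> m)) (h (\<sigma> n) (\<tau> n)) < \<epsilon>"
      if mn: "m \<ge> max N1 N2" "n \<ge> max N1 N2" for m n
    proof -
      have "nrm (\<sigma> m \<ominus> \<sigma> n) * nrm (\<tau> m) \<le> nrm (\<sigma> m \<ominus> \<sigma> n) * L"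
        using L cauchyD[OF \<sigma>] by (intro mult_left_mono) auto
      also have "\<dots> < \<epsilon> / 2" using N1[of m n] mn L by (simp add: field_simps)
      finally have 1: "nrm (\<sigma> m \<ominus> \<sigma> n) * nrm (\<tau> m) < \<epsilon> / 2" .
      have "nrm (\<sigma> n) * nrm (\<tau> m \<ominus> \<tau> n) \<le> K * nrm (\<tau> m \<ominus> \<tau> n)"
        using K cauchyD[OF \<tau>] by (intro mult_right_mono) auto
      also have "\<dots> < \<epsilon> / 2" using N2[of m n] mn K by (simp add: field_simps)
      finally show ?thesis
        using 1 form_diff_bound[of "\<sigma> m" "\<tau> m" "\<sigma> n" "\<tau> n"] cauchyD[OF \<sigma>] cauchyD[OF \<tau>]
        by (simp add: dist_norm)
    qed
    then show "\<exists>N. \<forall>m\<ge>N. \<forall>n\<ge>N. dist (h (\<sigma> m) (\<tau> m)) (h (\<sigma> n) (\<tau> n)) < \<epsilon>" by blast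
  qed
  then show ?thesis by (simp add: Cauchy_convergent_iff)
qed

end

section \<open>Cauchy sequences as a space with a form\<close>

context psd_space
begin

definition seq_module :: "(complex, nat \<Rightarrow> 'a) module" where
  "seq_module =
     \<lparr>carrier = Collect cauchy, monoid.mult = undefined, one = undefined,
      ring.zero = (\<lambda>n. \<zero>), add = (\<lambda>\<sigma> \<tau> n. \<sigma> n \<oplus> \<tau> n), smult = (\<lambda>c \<sigma> n. c \<odot> \<sigma> n)\<rparr>"

definition seq_form :: "(nat \<Rightarrow> 'a) \<Rightarrow> (nat \<Rightarrow> 'a) \<Rightarrow> complex" where
  "seq_form \<sigma> \<tau> = lim (\<lambda>n. h (\<sigma> n) (\<tau> n))"

lemma seq_module_simps [simp]:
  "carrier seq_module = Collect cauchy" "\<zero>\<^bsub>seq_module\<^esub> = (\<lambda>n. \<zero>)"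
  "\<sigma> \<oplus>\<^bsub>seq_module\<^esub> \<tau> = (\<lambda>n. \<sigma> n \<oplus> \<tau> n)" "c \<odot>\<^bsub>seq_module\<^esub> \<sigma> = (\<lambda>n. c \<odot> \<sigma> n)"
  by (simp_all add: seq_module_def)

lemma cauchy_const: "x \<in> carrier V \<Longrightarrow> cauchy (\<lambda>n. x)"
  using conv_const conv_imp_cauchy by blast

lemma module_seq: "Module.module complex_ring seq_module"
proof (rule moduleI[OF cring_complex_ring])
  show "abelian_group seq_module"
  proof (rule abelian_groupI)
    fix \<sigma> assume "\<sigma> \<in> carrier seq_module"
    then have \<sigma>: "cauchy \<sigma>" by simp
    \<comment> \<open>Inverses are taken as multiples by -1, so that closure of the Cauchy sequences
      under scalars also covers negation.\<close>
    have "(-1) \<odot> x \<oplus> x = \<zero>" if "x \<in> carrier V" for x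
      using add_smult[OF that, of "-1" 1] that by simp
    then show "\<exists>\<tau>\<in>carrier seq_module. \<tau> \<oplus>\<^bsub>seq_module\<^esub> \<sigma> = \<zero>\<^bsub>seq_module\<^esub>"
      using cauchy_smult[OF \<sigma>, of "-1"] cauchyD[OF \<sigma>]
      by (intro bexI[of _ "\<lambda>n. (-1) \<odot> \<sigma> n"]) auto
  qed (auto simp: cauchy_add cauchy_const cauchyD M.a_ac fun_eq_iff)
qed (auto simp: cauchy_smult cauchyD add_smult smult_add smult_smult fun_eq_iff)

lemma seq_form_tendsto:
  "cauchy \<sigma> \<Longrightarrow> cauchy \<tau> \<Longrightarrow> (\<lambda>n. h (\<sigma> n) (\<tau> n)) \<longlonglongrightarrow> seq_form \<sigma> \<tau>"
  using cauchy_form_convergent unfolding seq_form_def convergent_LIMSEQ_iff by blast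

lemma seq_form_eqI:
  "cauchy \<sigma> \<Longrightarrow> cauchy \<tau> \<Longrightarrow> (\<lambda>n. h (\<sigma> n) (\<tau> n)) \<longlonglongrightarrow> z \<Longrightarrow> seq_form \<sigma> \<tau> = z"
  using seq_form_tendsto LIMSEQ_unique by blast

lemma psd_space_seq: "psd_space seq_module seq_form"
proof (intro psd_space.intro psd_space_axioms.intro module_seq)
  show "psd_hermitian_form seq_module seq_form"
    unfolding psd_hermitian_form_def seq_module_simps mem_Collect_eq Ball_def
  proof (intro conjI allI impI)
    fix \<sigma> \<tau> \<rho> assume *: "cauchy \<sigma>" "cauchy \<tau>" "cauchy \<rho>"
    have "(\<lambda>n. h (\<sigma> n) (\<tau> n \<oplus> \<rho> n)) \<longlonglongrightarrow> seq_form \<sigma> \<tau> + seq_form \<sigma> \<rho>"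
      using tendsto_add[OF seq_form_tendsto seq_form_tendsto, OF *(1,2) *(1,3)]
      by (simp add: form_add_right * cauchyD)
    then show "seq_form \<sigma> (\<lambda>n. \<tau> n \<oplus> \<rho> n) = seq_form \<sigma> \<tau> + seq_form \<sigma> \<rho>"
      by (intro seq_form_eqI * cauchy_add)
  next
    fix \<sigma> \<tau> and c :: complex assume *: "cauchy \<sigma>" "cauchy \<tau>"
    have "(\<lambda>n. h (\<sigma> n) (c \<odot> \<tau> n)) \<longlonglongrightarrow> c * seq_form \<sigma> \<tau>"
      using tendsto_mult[OF tendsto_const seq_form_tendsto[OF *]]
      by (simp add: form_smult_right * cauchyD)
    then show "seq_form \<sigma> (\<lambda>n. c \<odot> \<tau> n) = c * seq_form \<sigma> \<tau>"
      by (intro seq_form_eqI * cauchy_smult)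
  next
    fix \<sigma> \<tau> assume *: "cauchy \<sigma>" "cauchy \<tau>"
    have "(\<lambda>n. h (\<tau> n) (\<sigma> n)) = (\<lambda>n. cnj (h (\<sigma> n) (\<tau> n)))"
      using form_herm cauchyD * by blast
    with tendsto_cnj[OF seq_form_tendsto[OF *]]
    have "(\<lambda>n. h (\<tau> n) (\<sigma> n)) \<longlonglongrightarrow> cnj (seq_form \<sigma> \<tau>)" by simp
    then show "seq_form \<tau> \<sigma> = cnj (seq_form \<sigma> \<tau>)"
      by (intro seq_form_eqI *)
  next
    fix \<sigma> assume *: "cauchy \<sigma>"
    show "seq_form \<sigma> \<sigma> \<in> \<real>\<^sub>\<ge>\<^sub>0"
      by (rule closed_sequentially[OF closed_nonneg_Reals_complex _ seq_form_tendsto[OF * *]])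
         (simp add: form_self cauchyD[OF *])
  qed
qed

text \<open>Subtraction in \<open>seq_module\<close> is defined through abstract inverses of the
  additive group and is not pointwise by definition. The pointwise formula follows by cancelling
  \<open>\<tau> n\<close> in each coordinate.\<close>

lemma seq_minus:
  assumes "cauchy \<sigma>" "cauchy \<tau>"
  shows "\<sigma> \<ominus>\<^bsub>seq_module\<^esub> \<tau> = (\<lambda>n. \<sigma> n \<ominus> \<tau> n)"
proof -
  interpret S: psd_space seq_module seq_form by (rule psd_space_seq)
  have 1: "cauchy (\<sigma> \<ominus>\<^bsub>seq_module\<^esub> \<tau>)"
    using S.M.minus_closed[of \<sigma> \<tau>] assms by simp
  have 2: "(\<sigma> \<ominus>\<^bsub>seq_module\<^esub> \<tau>) n \<oplus> \<tau> n = \<sigma> n" for n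
    using S.diff_add_cancel[of \<sigma> \<tau>] assms by (simp add: fun_eq_iff)
  have "(\<sigma> \<ominus>\<^bsub>seq_module\<^esub> \<tau>) n = \<sigma> n \<ominus> \<tau> n" for n
    using M.add.right_cancel[THEN iffD1, of "\<tau> n" "(\<sigma> \<ominus>\<^bsub>seq_module\<^esub> \<tau>) n" "\<sigma> n \<ominus> \<tau> n"]
      2[of n] cauchyD[OF 1] cauchyD[OF assms(1)] cauchyD[OF assms(2)] by simp
  then show ?thesis by (simp add: fun_eq_iff)
qed

lemma seq_nrm_tendsto:
  assumes "cauchy \<sigma>"
  shows "(\<lambda>n. nrm (\<sigma> n)) \<longlonglongrightarrow> psd_space.nrm seq_form \<sigma>"
proof -
  interpret S: psd_space seq_module seq_form by (rule psd_space_seq)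
  show ?thesis
    unfolding nrm_def S.nrm_def
    by (intro tendsto_real_sqrt tendsto_Re seq_form_tendsto assms)
qed

end

section \<open>Definite forms and the associated metric\<close>

locale inner_space = psd_space V "cinner V" for V :: "'a hspace" (structure) +
  assumes definite: "x \<in> carrier V \<Longrightarrow> cinner V x x = 0 \<Longrightarrow> x = \<zero>"

lemma complex_inner_space_iff: "complex_inner_space V \<longleftrightarrow> inner_space V"
  unfolding complex_inner_space_def inner_space_def inner_space_axioms_def psd_space_def
    psd_space_axioms_def by blast

text \<open>Every element of \<open>W\<close> has a representative in \<open>V\<close>, so each
  axiom for \<open>W\<close> is the image under \<open>p\<close> of the same axiom for
  \<open>V\<close>. Definiteness alone needs \<open>null\<close>. This is applied once to cosets and
  once to classes of Cauchy sequences.\<close>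

lemma (in psd_space) inner_space_image:
  fixes W :: "'w hspace" and p :: "'a \<Rightarrow> 'w"
  assumes carrier: "carrier W = p ` carrier V"
    and add: "\<And>x y. x \<in> carrier V \<Longrightarrow> y \<in> carrier V \<Longrightarrow> p x \<oplus>\<^bsub>W\<^esub> p y = p (x \<oplus> y)"
    and smult: "\<And>c x. x \<in> carrier V \<Longrightarrow> c \<odot>\<^bsub>W\<^esub> p x = p (c \<odot> x)"
    and zero: "\<zero>\<^bsub>W\<^esub> = p \<zero>"
    and form: "\<And>x y. x \<in> carrier V \<Longrightarrow> y \<in> carrier V \<Longrightarrow> cinner W (p x) (p y) = h x y"
    and null: "\<And>x. x \<in> carrier V \<Longrightarrow> h x x = 0 \<Longrightarrow> p x = p \<zero>"
  shows "inner_space W"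
proof (intro inner_space.intro psd_space.intro psd_space_axioms.intro inner_space_axioms.intro)
  show "Module.module complex_ring W"
  proof (rule moduleI[OF cring_complex_ring])
    show "abelian_group W"
    proof (rule abelian_groupI)
      fix X assume "X \<in> carrier W"
      then obtain x where x: "x \<in> carrier V" "X = p x" using carrier by auto
      have "p (\<ominus> x) \<in> carrier W" "p (\<ominus> x) \<oplus>\<^bsub>W\<^esub> X = \<zero>\<^bsub>W\<^esub>"
        using x by (auto simp: carrier add zero M.l_neg)
      then show "\<exists>Y\<in>carrier W. Y \<oplus>\<^bsub>W\<^esub> X = \<zero>\<^bsub>W\<^esub>" by blast
    qed (auto simp: carrier add zero M.a_ac)
  qed (auto simp: carrier add smult add_smult smult_add smult_smult)
  show "psd_hermitian_form W (cinner W)"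
    unfolding psd_hermitian_form_def carrier
    by (auto simp: add smult form form_add_right form_smult_right form_self intro: form_herm)
  show "x = \<zero>\<^bsub>W\<^esub>" if "x \<in> carrier W" "cinner W x x = 0" for x
  proof -
    obtain y where "y \<in> carrier V" "x = p y" using \<open>x \<in> carrier W\<close> carrier by auto
    then show ?thesis using that(2) null[of y] form[of y y] zero by metis
  qed
qed

context inner_space
begin

lemma eqI:
  assumes "x \<in> carrier V" "y \<in> carrier V" "nrm (x \<ominus> y) = 0"
  shows "x = y"
  using assms definite[of "x \<ominus> y"] nrm_eq_0_iff[of "x \<ominus> y"] diff_zero_iff by simp

lemma conv_unique:
  assumes "conv \<sigma> x" "conv \<sigma> y"
  shows "x = y"
proof (rule eqI)
  have *: "nrm (x \<ominus> y) \<le> nrm (\<sigma> n \<ominus> x) + nrm (\<sigma> n \<ominus> y)" for n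
    using dist_triangle[of x "\<sigma> n" y] nrm_diff_commute[of x "\<sigma> n"]
      convD[OF assms(1)] convD[OF assms(2)] by simp
  have "nrm (x \<ominus> y) \<le> 0 + 0"
    by (rule tendsto_lowerbound[OF tendsto_add[OF conv_dist[OF assms(1)] conv_dist[OF assms(2)]]])
       (simp_all add: *)
  then show "nrm (x \<ominus> y) = 0"
    using convD[OF assms(1)] convD[OF assms(2)] by (intro order_antisym) auto
qed (use convD[OF assms(1)] convD[OF assms(2)] in auto)

lemma cnorm_eq_nrm: "cnorm V = nrm"
  by (simp add: cnorm_def nrm_def fun_eq_iff)

lemma cdist_eq: "x \<in> carrier V \<Longrightarrow> y \<in> carrier V \<Longrightarrow> cdist V x y = nrm (x \<ominus> y)"
  by (simp add: cdist_def cnorm_eq_nrm)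

lemma metric_space: "Metric_space (carrier V) (cdist V)"
proof
  show "0 \<le> cdist V x y" for x y by (simp add: cdist_def cnorm_eq_nrm)
  show "cdist V x y = cdist V y x" for x y
    by (simp add: cdist_def cnorm_eq_nrm nrm_diff_commute)
  show "cdist V x y = 0 \<longleftrightarrow> x = y" if "x \<in> carrier V" "y \<in> carrier V" for x y
    using that eqI[of x y] by (auto simp: cdist_eq)
qed (simp add: cdist_eq dist_triangle)

text \<open>Since \<open>cdist\<close> is 0 off the carrier, small distances do not force a sequence
  into the carrier. The range condition, which both notions contain, is therefore settled
  first.\<close>

lemma MCauchy_iff: "Metric_space.MCauchy (carrier V) (cdist V) \<sigma> \<longleftrightarrow> cauchy \<sigma>"
proof -
  interpret Metric_space "carrier V" "cdist V" by (rule metric_space)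
  show ?thesis
  proof (cases "range \<sigma> \<subseteq> carrier V")
    case True
    then have "cdist V (\<sigma> m) (\<sigma> n) = nrm (\<sigma> m \<ominus> \<sigma> n)" for m n
      by (intro cdist_eq) auto
    with True show ?thesis
      unfolding MCauchy_def cauchy_def by (simp add: image_subset_iff)
  qed (auto simp: MCauchy_def cauchy_def)
qed

lemma mcomplete_iff:
  "Metric_space.mcomplete (carrier V) (cdist V) \<longleftrightarrow> (\<forall>\<sigma>. cauchy \<sigma> \<longrightarrow> (\<exists>x. conv \<sigma> x))"
proof -
  interpret Metric_space "carrier V" "cdist V" by (rule metric_space)
  have "limitin mtopology \<sigma> x sequentially \<longleftrightarrow> conv \<sigma> x" if "cauchy \<sigma>" for \<sigma> x
    unfolding limitin_metric_dist_null conv_def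
    using cauchyD[OF that] by (auto simp: cdist_eq)
  then show ?thesis
    unfolding mcomplete_def MCauchy_iff by blast
qed

text \<open>The pointwise distances always converge, namely to the seminorm of the difference
  sequence. By uniqueness of limits they tend to 0 exactly when this seminorm vanishes.\<close>

lemma cauchy_rel_eq: "cauchy_rel V = psd_space.equivalence seq_module seq_form"
proof -
  interpret S: psd_space seq_module seq_form by (rule psd_space_seq)
  have "(\<lambda>n. cdist V (\<sigma> n) (\<tau> n)) \<longlonglongrightarrow> 0 \<longleftrightarrow> S.nrm (\<sigma> \<ominus>\<^bsub>seq_module\<^esub> \<tau>) = 0"
    if *: "cauchy \<sigma>" "cauchy \<tau>" for \<sigma> \<tau>
  proof -
    have "cauchy (\<sigma> \<ominus>\<^bsub>seq_module\<^esub> \<tau>)" using S.M.minus_closed[of \<sigma> \<tau>] * by simp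
    from seq_nrm_tendsto[OF this] have "(\<lambda>n. cdist V (\<sigma> n) (\<tau> n)) \<longlonglongrightarrow> S.nrm (\<sigma> \<ominus>\<^bsub>seq_module\<^esub> \<tau>)"
      by (simp add: seq_minus[OF *] cdist_eq cauchyD[OF *(1)] cauchyD[OF *(2)])
    then show ?thesis using LIMSEQ_unique by auto
  qed
  then show ?thesis
    unfolding cauchy_rel_def S.equivalence_def MCauchy_iff by auto
qed

end

section \<open>Quotient and completion\<close>

context psd_space
begin

text \<open>The null space is the zero set of the seminorm, so the triangle inequality gives sums
  and homogeneity with factor -1 gives inverses.\<close>

lemma additive_subgroup_null_space: "additive_subgroup (null_space V h) V"
proof -
  have null: "null_space V h = {x \<in> carrier V. nrm x = 0}"
    by (auto simp: null_space_def nrm_eq_0_iff)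
  have "\<ominus> x = (-1) \<odot> x" if "x \<in> carrier V" for x
    using add_smult[OF that, of "-1" 1] that by (intro M.minus_equality) auto
  then have uminus: "nrm (\<ominus> x) = nrm x" if "x \<in> carrier V" for x
    using that by (simp add: nrm_smult)
  have add: "nrm (x \<oplus> y) = 0" if "x \<in> carrier V" "y \<in> carrier V" "nrm x = 0" "nrm y = 0" for x y
    using nrm_triangle[of x y] that by (intro order_antisym) auto
  have "subgroup (null_space V h) (add_monoid V)"
    by (rule M.add.subgroupI)
      (auto simp: null add uminus intro!: exI[of _ "\<zero>"])
  then show ?thesis by (rule additive_subgroup.intro)
qed

lemma abelian_subgroup_null_space: "abelian_subgroup (null_space V h) V"
  by (rule abelian_subgroupI3[OF additive_subgroup_null_space M.abelian_group_axioms])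

text \<open>Lets the general facts on classes of \<open>equivalence\<close> compute the scalar
  multiples and the form of the quotient, which are defined by unions and descriptions over
  cosets.\<close>

lemma coset_eq_class:
  assumes x: "x \<in> carrier V"
  shows "null_space V h +> x = equivalence `` {x}"
proof -
  have "y \<in> null_space V h +> x \<longleftrightarrow> (x, y) \<in> equivalence" for y
  proof
    assume "y \<in> null_space V h +> x"
    then obtain n where n: "n \<in> carrier V" "h n n = 0" "y = n \<oplus> x"
      by (auto simp: a_r_coset_def' null_space_def)
    have "y \<ominus> x = n"
      using n x by (simp add: a_minus_def M.a_assoc M.r_neg)
    then show "(x, y) \<in> equivalence"
      using n x nrm_diff_commute[of x y] by (simp add: equivalence_def nrm_eq_0_iff)
  next
    assume "(x, y) \<in> equivalence"
    then have y: "y \<in> carrier V" "nrm (y \<ominus> x) = 0"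
      using x by (auto simp: equivalence_def nrm_diff_commute)
    then have "y \<ominus> x \<in> null_space V h" "y = (y \<ominus> x) \<oplus> x"
      using x nrm_eq_0_iff[of "y \<ominus> x"] by (auto simp: null_space_def)
    then show "y \<in> null_space V h +> x"
      unfolding a_r_coset_def' by blast
  qed
  then show ?thesis by blast
qed

lemma quotient_space_simps:
  "carrier (quotient_space V h) = (\<lambda>x. null_space V h +> x) ` carrier V"
  "x \<in> carrier V \<Longrightarrow> y \<in> carrier V \<Longrightarrow>
    (null_space V h +> x) \<oplus>\<^bsub>quotient_space V h\<^esub> (null_space V h +> y) = null_space V h +> (x \<oplus> y)"
  "x \<in> carrier V \<Longrightarrow>
    c \<odot>\<^bsub>quotient_space V h\<^esub> (null_space V h +> x) = null_space V h +> (c \<odot> x)"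
  "\<zero>\<^bsub>quotient_space V h\<^esub> = null_space V h +> \<zero>"
  "x \<in> carrier V \<Longrightarrow> y \<in> carrier V \<Longrightarrow>
    cinner (quotient_space V h) (null_space V h +> x) (null_space V h +> y) = h x y"
proof -
  interpret N: abelian_subgroup "null_space V h" V by (rule abelian_subgroup_null_space)
  show "carrier (quotient_space V h) = (\<lambda>x. null_space V h +> x) ` carrier V"
    by (auto simp: quotient_space_def A_RCOSETS_def')
  show "(null_space V h +> x) \<oplus>\<^bsub>quotient_space V h\<^esub> (null_space V h +> y) =
      null_space V h +> (x \<oplus> y)" if "x \<in> carrier V" "y \<in> carrier V"
    using N.a_rcos_sum[OF that] by (simp add: quotient_space_def)
  show "\<zero>\<^bsub>quotient_space V h\<^esub> = null_space V h +> \<zero>"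
    using M.a_coset_add_zero[OF N.a_subset] by (simp add: quotient_space_def)
  show "c \<odot>\<^bsub>quotient_space V h\<^esub> (null_space V h +> x) = null_space V h +> (c \<odot> x)"
    if x: "x \<in> carrier V"
  proof -
    have "(\<Union>a\<in>equivalence `` {x}. null_space V h +> (c \<odot> a)) =
        (\<Union>a\<in>equivalence `` {x}. equivalence `` {c \<odot> a})"
      by (intro SUP_cong refl coset_eq_class) (auto simp: equivalence_def)
    with x show ?thesis by (simp add: quotient_space_def coset_eq_class class_smult)
  qed
  show "cinner (quotient_space V h) (null_space V h +> x) (null_space V h +> y) = h x y"
    if "x \<in> carrier V" "y \<in> carrier V"
    using class_form[OF that] that by (simp add: quotient_space_def coset_eq_class)
qed

lemma inner_space_quotient: "inner_space (quotient_space V h)"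
proof (rule inner_space_image[where p = "\<lambda>x. null_space V h +> x"])
  fix x assume x: "x \<in> carrier V" "h x x = 0"
  then have "(x, \<zero>) \<in> equivalence"
    using nrm_eq_0_iff[of x] by (simp add: equivalence_def)
  then show "null_space V h +> x = null_space V h +> \<zero>"
    using x by (simp add: coset_eq_class equiv_class_eq[OF equiv_equivalence])
qed (simp_all add: quotient_space_simps)

end

section \<open>The completion and dense isometric embeddings\<close>

context inner_space
begin

lemma completion_space_simps:
  "carrier (completion_space V) = (\<lambda>\<sigma>. cauchy_rel V `` {\<sigma>}) ` Collect cauchy"
  "cauchy \<sigma> \<Longrightarrow> cauchy \<tau> \<Longrightarrow>
    (cauchy_rel V `` {\<sigma>}) \<oplus>\<^bsub>completion_space V\<^esub> (cauchy_rel V `` {\<tau>}) =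
    cauchy_rel V `` {\<lambda>n. \<sigma> n \<oplus> \<tau> n}"
  "cauchy \<sigma> \<Longrightarrow>
    c \<odot>\<^bsub>completion_space V\<^esub> (cauchy_rel V `` {\<sigma>}) = cauchy_rel V `` {\<lambda>n. c \<odot> \<sigma> n}"
  "\<zero>\<^bsub>completion_space V\<^esub> = cauchy_rel V `` {\<lambda>n. \<zero>}"
  "cauchy \<sigma> \<Longrightarrow> cauchy \<tau> \<Longrightarrow>
    cinner (completion_space V) (cauchy_rel V `` {\<sigma>}) (cauchy_rel V `` {\<tau>}) = seq_form \<sigma> \<tau>"
proof -
  interpret S: psd_space seq_module seq_form by (rule psd_space_seq)
  show "carrier (completion_space V) = (\<lambda>\<sigma>. cauchy_rel V `` {\<sigma>}) ` Collect cauchy"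
    by (auto simp: completion_space_def quotient_def MCauchy_iff)
  show "\<zero>\<^bsub>completion_space V\<^esub> = cauchy_rel V `` {\<lambda>n. \<zero>}"
    by (simp add: completion_space_def)
  show "(cauchy_rel V `` {\<sigma>}) \<oplus>\<^bsub>completion_space V\<^esub> (cauchy_rel V `` {\<tau>}) =
      cauchy_rel V `` {\<lambda>n. \<sigma> n \<oplus> \<tau> n}" if "cauchy \<sigma>" "cauchy \<tau>"
    using S.class_add[of \<sigma> \<tau>] that by (simp add: completion_space_def cauchy_rel_eq)
  show "c \<odot>\<^bsub>completion_space V\<^esub> (cauchy_rel V `` {\<sigma>}) = cauchy_rel V `` {\<lambda>n. c \<odot> \<sigma> n}"
    if "cauchy \<sigma>"
    using S.class_smult[of \<sigma> c] that by (simp add: completion_space_def cauchy_rel_eq)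
  show "cinner (completion_space V) (cauchy_rel V `` {\<sigma>}) (cauchy_rel V `` {\<tau>}) = seq_form \<sigma> \<tau>"
    if st: "cauchy \<sigma>" "cauchy \<tau>"
  proof -
    \<comment> \<open>The definition of the scalar product asks for a limit. Representatives are
      Cauchy, so this limit exists and equals \<open>seq_form\<close>, which brings the description
      into the shape of \<open>class_form\<close>.\<close>
    have "(\<exists>a\<in>S.equivalence `` {\<sigma>}. \<exists>b\<in>S.equivalence `` {\<tau>}. (\<lambda>n. cinner V (a n) (b n)) \<longlonglongrightarrow> z) \<longleftrightarrow>
        (\<exists>a\<in>S.equivalence `` {\<sigma>}. \<exists>b\<in>S.equivalence `` {\<tau>}. z = seq_form a b)" for z
    proof (intro bex_cong refl)
      fix a b assume "a \<in> S.equivalence `` {\<sigma>}" "b \<in> S.equivalence `` {\<tau>}"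
      then have "cauchy a" "cauchy b" by (auto simp: S.equivalence_def)
      then show "(\<lambda>n. cinner V (a n) (b n)) \<longlonglongrightarrow> z \<longleftrightarrow> z = seq_form a b"
        using seq_form_tendsto seq_form_eqI by metis
    qed
    then show ?thesis
      using S.class_form[of \<sigma> \<tau>] st by (simp add: completion_space_def cauchy_rel_eq)
  qed
qed

lemma inner_space_completion: "inner_space (completion_space V)"
proof -
  interpret S: psd_space seq_module seq_form by (rule psd_space_seq)
  show ?thesis
  proof (rule S.inner_space_image[where p = "\<lambda>\<sigma>. cauchy_rel V `` {\<sigma>}"])
    fix \<sigma> assume \<sigma>: "\<sigma> \<in> carrier seq_module" "seq_form \<sigma> \<sigma> = 0"
    then have "(\<sigma>, \<zero>\<^bsub>seq_module\<^esub>) \<in> S.equivalence"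
      using S.nrm_eq_0_iff[of \<sigma>] S.M.zero_closed unfolding S.equivalence_def
      by (simp del: seq_module_simps)
    then show "cauchy_rel V `` {\<sigma>} = cauchy_rel V `` {\<zero>\<^bsub>seq_module\<^esub>}"
      unfolding cauchy_rel_eq by (rule equiv_class_eq[OF S.equiv_equivalence])
  qed (simp_all add: completion_space_simps)
qed

end

text \<open>Linearity of \<open>q\<close> is not assumed: it follows from preservation of the form,
  because the target is definite. The locale is used for a space in its completion and for
  \<open>F\<close> in the associated space, where \<open>q\<close> need not be injective.\<close>

locale dense_isometry = psd_space V h + W: inner_space W
  for V :: "(complex, 'a, 'b) module_scheme" (structure) and h and W :: "'w hspace" +
  fixes q :: "'a \<Rightarrow> 'w"
  assumes q_closed [simp]: "x \<in> carrier V \<Longrightarrow> q x \<in> carrier W"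
    and q_form: "x \<in> carrier V \<Longrightarrow> y \<in> carrier V \<Longrightarrow> cinner W (q x) (q y) = h x y"
    and q_dense: "w \<in> carrier W \<Longrightarrow> \<exists>\<sigma>. (\<forall>n. \<sigma> n \<in> carrier V) \<and> W.conv (\<lambda>n. q (\<sigma> n)) w"
begin

lemma q_nrm: "x \<in> carrier V \<Longrightarrow> W.nrm (q x) = nrm x"
  by (simp add: nrm_def W.nrm_def q_form)

lemma q_dist:
  assumes "x \<in> carrier V" "y \<in> carrier V"
  shows "W.nrm (q x \<ominus>\<^bsub>W\<^esub> q y) = nrm (x \<ominus> y)"
proof -
  have "cinner W (q x \<ominus>\<^bsub>W\<^esub> q y) (q x \<ominus>\<^bsub>W\<^esub> q y) = h (x \<ominus> y) (x \<ominus> y)"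
    using assms by (simp add: W.form_simps form_simps q_form)
  then show ?thesis by (simp add: nrm_def W.nrm_def)
qed

text \<open>Expanding the form of the difference of the two sides with itself leaves only values of
  \<open>h\<close>, which cancel; definiteness of \<open>W\<close> concludes.\<close>

lemma q_add:
  assumes "x \<in> carrier V" "y \<in> carrier V"
  shows "q (x \<oplus> y) = q x \<oplus>\<^bsub>W\<^esub> q y"
proof (rule W.eqI)
  have "cinner W (q (x \<oplus> y) \<ominus>\<^bsub>W\<^esub> (q x \<oplus>\<^bsub>W\<^esub> q y)) (q (x \<oplus> y) \<ominus>\<^bsub>W\<^esub> (q x \<oplus>\<^bsub>W\<^esub> q y)) = 0"
    using assms by (simp add: W.form_simps form_simps q_form)
  then show "W.nrm (q (x \<oplus> y) \<ominus>\<^bsub>W\<^esub> (q x \<oplus>\<^bsub>W\<^esub> q y)) = 0" by (simp add: W.nrm_def)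
qed (use assms in auto)

lemma q_smult:
  assumes "x \<in> carrier V"
  shows "q (c \<odot> x) = c \<odot>\<^bsub>W\<^esub> q x"
proof (rule W.eqI)
  have "cinner W (q (c \<odot> x) \<ominus>\<^bsub>W\<^esub> (c \<odot>\<^bsub>W\<^esub> q x)) (q (c \<odot> x) \<ominus>\<^bsub>W\<^esub> (c \<odot>\<^bsub>W\<^esub> q x)) = 0"
    using assms by (simp add: W.form_simps form_simps q_form)
  then show "W.nrm (q (c \<odot> x) \<ominus>\<^bsub>W\<^esub> (c \<odot>\<^bsub>W\<^esub> q x)) = 0" by (simp add: W.nrm_def)
qed (use assms in auto)

lemma q_cauchy_iff:
  assumes "\<And>n. \<sigma> n \<in> carrier V"
  shows "W.cauchy (\<lambda>n. q (\<sigma> n)) \<longleftrightarrow> cauchy \<sigma>"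
  using assms by (simp add: W.cauchy_def cauchy_def q_dist)

text \<open>An arbitrary Cauchy sequence \<open>X\<close> is replaced by images
  \<open>q (x k)\<close> whose distance to \<open>X k\<close> is below \<open>1 / (k + 1)\<close>.
  The replacement is again Cauchy, and its limit is a limit of \<open>X\<close>.\<close>

lemma complete_if_conv:
  assumes conv: "\<And>\<sigma>. cauchy \<sigma> \<Longrightarrow> \<exists>w. W.conv (\<lambda>n. q (\<sigma> n)) w"
    and X: "W.cauchy X"
  shows "\<exists>w. W.conv X w"
proof -
  have "\<exists>x\<in>carrier V. W.nrm (q x \<ominus>\<^bsub>W\<^esub> X k) < inverse (real (Suc k))" for k
  proof -
    obtain \<sigma> where \<sigma>: "\<forall>n. \<sigma> n \<in> carrier V" "W.conv (\<lambda>n. q (\<sigma> n)) (X k)"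
      using q_dense[OF W.cauchyD[OF X]] by blast
    have "\<forall>\<^sub>F n in sequentially. W.nrm (q (\<sigma> n) \<ominus>\<^bsub>W\<^esub> X k) < inverse (real (Suc k))"
      by (rule order_tendstoD(2)[OF W.conv_dist[OF \<sigma>(2)]]) simp
    then obtain n where "W.nrm (q (\<sigma> n) \<ominus>\<^bsub>W\<^esub> X k) < inverse (real (Suc k))"
      by (auto simp: eventually_sequentially)
    with \<sigma> show ?thesis by blast
  qed
  then obtain x where x: "\<And>k. x k \<in> carrier V"
    "\<And>k. W.nrm (q (x k) \<ominus>\<^bsub>W\<^esub> X k) < inverse (real (Suc k))" by metis
  have lim: "(\<lambda>k. W.nrm (q (x k) \<ominus>\<^bsub>W\<^esub> X k)) \<longlonglongrightarrow> 0"
    by (rule tendsto_sandwich[OF _ _ tendsto_const LIMSEQ_inverse_real_of_nat])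
       (use x W.cauchyD[OF X] in \<open>auto simp: less_imp_le\<close>)
  have "W.cauchy (\<lambda>k. q (x k))"
    unfolding W.cauchy_def
  proof (intro conjI allI impI)
    fix \<epsilon> :: real assume "\<epsilon> > 0"
    then have "\<epsilon> / 3 > 0" by simp
    then obtain N1 where N1: "\<And>m n. m \<ge> N1 \<Longrightarrow> n \<ge> N1 \<Longrightarrow> W.nrm (X m \<ominus>\<^bsub>W\<^esub> X n) < \<epsilon> / 3"
      using X unfolding W.cauchy_def by meson
    obtain N2 where N2: "\<And>k. k \<ge> N2 \<Longrightarrow> W.nrm (q (x k) \<ominus>\<^bsub>W\<^esub> X k) < \<epsilon> / 3"
      using order_tendstoD(2)[OF lim \<open>\<epsilon> / 3 > 0\<close>] by (auto simp: eventually_sequentially)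
    have "W.nrm (q (x m) \<ominus>\<^bsub>W\<^esub> q (x n)) < \<epsilon>" if "m \<ge> max N1 N2" "n \<ge> max N1 N2" for m n
      using N1[of m n] N2[of m] N2[of n] that W.cauchyD[OF X] x(1)
        W.dist_triangle[of "q (x m)" "X m" "q (x n)"] W.dist_triangle[of "X m" "X n" "q (x n)"]
        W.nrm_diff_commute[of "q (x n)" "X n"] by simp
    then show "\<exists>N. \<forall>m\<ge>N. \<forall>n\<ge>N. W.nrm (q (x m) \<ominus>\<^bsub>W\<^esub> q (x n)) < \<epsilon>" by blast
  qed (use x in simp)
  then obtain w where w: "W.conv (\<lambda>k. q (x k)) w"
    using conv q_cauchy_iff x(1) by blast
  have "W.conv X w"
  proof (rule W.convI_bound)
    show "(\<lambda>k. W.nrm (q (x k) \<ominus>\<^bsub>W\<^esub> X k) + W.nrm (q (x k) \<ominus>\<^bsub>W\<^esub> w)) \<longlonglongrightarrow> 0"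
      using tendsto_add[OF lim W.conv_dist[OF w]] by simp
    show "W.nrm (X k \<ominus>\<^bsub>W\<^esub> w) \<le> W.nrm (q (x k) \<ominus>\<^bsub>W\<^esub> X k) + W.nrm (q (x k) \<ominus>\<^bsub>W\<^esub> w)" for k
      using W.dist_triangle[of "X k" "q (x k)" w] W.nrm_diff_commute[of "X k" "q (x k)"]
        W.cauchyD[OF X] x(1) W.convD(2)[OF w] by simp
  qed (use W.cauchyD[OF X] W.convD(2)[OF w] in auto)
  then show ?thesis ..
qed

end

context inner_space
begin

text \<open>The terms of a Cauchy sequence, embedded as constant sequences, converge to its class.
  This yields density of \<open>V\<close> and, with \<open>complete_if_conv\<close>,
  completeness.\<close>

lemma completion_conv:
  assumes \<sigma>: "cauchy \<sigma>"
  shows "psd_space.conv (completion_space V) (cinner (completion_space V))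
    (\<lambda>k. cauchy_rel V `` {\<lambda>n. \<sigma> k}) (cauchy_rel V `` {\<sigma>})"
proof -
  interpret W: inner_space "completion_space V" by (rule inner_space_completion)
  interpret S: psd_space seq_module seq_form by (rule psd_space_seq)
  let ?j = "\<lambda>\<tau>. cauchy_rel V `` {\<tau>}"
  have j: "?j \<tau> \<in> carrier (completion_space V)" if "cauchy \<tau>" for \<tau>
    using that by (simp add: completion_space_simps)
  have const: "cauchy (\<lambda>n. \<sigma> k)" for k using cauchy_const cauchyD[OF \<sigma>] by blast
  \<comment> \<open>The distance in the completion is the limit of the distances to the later terms
    of the sequence.\<close>
  have dist: "(\<lambda>n. nrm (\<sigma> k \<ominus> \<sigma> n)) \<longlonglongrightarrow>
      W.nrm (?j (\<lambda>n. \<sigma> k) \<ominus>\<^bsub>completion_space V\<^esub> ?j \<sigma>)" for k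
  proof -
    have "cinner (completion_space V) (?j (\<lambda>n. \<sigma> k) \<ominus>\<^bsub>completion_space V\<^esub> ?j \<sigma>)
        (?j (\<lambda>n. \<sigma> k) \<ominus>\<^bsub>completion_space V\<^esub> ?j \<sigma>) =
        seq_form ((\<lambda>n. \<sigma> k) \<ominus>\<^bsub>seq_module\<^esub> \<sigma>) ((\<lambda>n. \<sigma> k) \<ominus>\<^bsub>seq_module\<^esub> \<sigma>)"
      using S.M.minus_closed[of "\<lambda>n. \<sigma> k" \<sigma>]
      by (simp add: W.form_simps S.form_simps completion_space_simps(5) j const \<sigma>)
    moreover have "cauchy ((\<lambda>n. \<sigma> k) \<ominus>\<^bsub>seq_module\<^esub> \<sigma>)"
      using S.M.minus_closed[of "\<lambda>n. \<sigma> k" \<sigma>] const \<sigma> by simp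
    from seq_nrm_tendsto[OF this]
    have "(\<lambda>n. nrm (\<sigma> k \<ominus> \<sigma> n)) \<longlonglongrightarrow> S.nrm ((\<lambda>n. \<sigma> k) \<ominus>\<^bsub>seq_module\<^esub> \<sigma>)"
      by (simp add: seq_minus const \<sigma>)
    ultimately show ?thesis by (simp add: W.nrm_def S.nrm_def)
  qed
  show ?thesis
    unfolding W.conv_def
  proof (intro conjI allI j const \<sigma>)
    show "(\<lambda>k. W.nrm (?j (\<lambda>n. \<sigma> k) \<ominus>\<^bsub>completion_space V\<^esub> ?j \<sigma>)) \<longlonglongrightarrow> 0"
    proof (rule LIMSEQ_I)
      fix \<epsilon> :: real assume "\<epsilon> > 0"
      then have "\<epsilon> / 2 > 0" by simp
      then obtain N where N: "\<And>m n. m \<ge> N \<Longrightarrow> n \<ge> N \<Longrightarrow> nrm (\<sigma> m \<ominus> \<sigma> n) < \<epsilon> / 2"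
        using \<sigma> unfolding cauchy_def by meson
      \<comment> \<open>Passing to the limit turns a strict bound into a weak one, hence
        \<open>\<epsilon> / 2\<close> here.\<close>
      have "W.nrm (?j (\<lambda>n. \<sigma> k) \<ominus>\<^bsub>completion_space V\<^esub> ?j \<sigma>) \<le> \<epsilon> / 2" if "k \<ge> N" for k
        by (rule tendsto_upperbound[OF dist])
           (use N that in \<open>auto simp: eventually_sequentially intro!: exI[of _ N] less_imp_le\<close>)
      moreover have "W.nrm (?j (\<lambda>n. \<sigma> k) \<ominus>\<^bsub>completion_space V\<^esub> ?j \<sigma>) \<ge> 0" for k
        using j const \<sigma> by simp
      ultimately show "\<exists>N. \<forall>k\<ge>N.
          norm (W.nrm (?j (\<lambda>n. \<sigma> k) \<ominus>\<^bsub>completion_space V\<^esub> ?j \<sigma>) - 0) < \<epsilon>"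
        using \<open>\<epsilon> > 0\<close> by (intro exI[of _ N]) fastforce
    qed
  qed
qed

lemma dense_isometry_completion:
  "dense_isometry V (cinner V) (completion_space V) (\<lambda>x. cauchy_rel V `` {\<lambda>n. x})"
proof (intro dense_isometry.intro dense_isometry_axioms.intro inner_space_completion
    psd_space_axioms)
  show "cauchy_rel V `` {\<lambda>n. x} \<in> carrier (completion_space V)" if "x \<in> carrier V" for x
    using that by (simp add: completion_space_simps cauchy_const)
  show "cinner (completion_space V) (cauchy_rel V `` {\<lambda>n. x}) (cauchy_rel V `` {\<lambda>n. y}) = cinner V x y"
    if "x \<in> carrier V" "y \<in> carrier V" for x y
    using that by (simp add: completion_space_simps cauchy_const seq_form_eqI)
  show "\<exists>\<sigma>. (\<forall>n. \<sigma> n \<in> carrier V) \<and>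
      psd_space.conv (completion_space V) (cinner (completion_space V)) (\<lambda>n. cauchy_rel V `` {\<lambda>m. \<sigma> n}) w"
    if "w \<in> carrier (completion_space V)" for w
  proof -
    obtain \<sigma> where "cauchy \<sigma>" "w = cauchy_rel V `` {\<sigma>}"
      using \<open>w \<in> _\<close> unfolding completion_space_simps(1) by blast
    with completion_conv cauchyD show ?thesis by blast
  qed
qed

lemma complex_hilbert_space_completion: "complex_hilbert_space (completion_space V)"
proof -
  interpret D: dense_isometry V "cinner V" "completion_space V" "\<lambda>x. cauchy_rel V `` {\<lambda>n. x}"
    by (rule dense_isometry_completion)
  show ?thesis
    unfolding complex_hilbert_space_def complex_inner_space_iff
    using inner_space_completion D.W.mcomplete_iff D.complete_if_conv completion_conv by blast
qed

end

context psd_space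
begin

lemma complex_hilbert_space_associated: "complex_hilbert_space (associated_space V h)"
  unfolding associated_space_def
  by (rule inner_space.complex_hilbert_space_completion[OF inner_space_quotient])

text \<open>Every element of the quotient is a coset of a vector of \<open>V\<close>, so density of
  the quotient in its completion passes to \<open>V\<close> by choosing representatives.\<close>

lemma dense_isometry_associated:
  "dense_isometry V h (associated_space V h) (associated_map V h)"
proof -
  interpret Q: inner_space "quotient_space V h" by (rule inner_space_quotient)
  interpret D: dense_isometry "quotient_space V h" "cinner (quotient_space V h)"
    "completion_space (quotient_space V h)" "\<lambda>x. cauchy_rel (quotient_space V h) `` {\<lambda>n. x}"
    by (rule Q.dense_isometry_completion)
  have p: "null_space V h +> x \<in> carrier (quotient_space V h)" if "x \<in> carrier V" for x
    using that by (simp add: quotient_space_simps)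
  show ?thesis
    unfolding associated_space_def
  proof (intro dense_isometry.intro dense_isometry_axioms.intro D.W.inner_space_axioms
      psd_space_axioms)
    show "associated_map V h x \<in> carrier (completion_space (quotient_space V h))"
      if "x \<in> carrier V" for x
      using D.q_closed[OF p[OF that]] that by (simp add: associated_map_def)
    show "cinner (completion_space (quotient_space V h)) (associated_map V h x) (associated_map V h y)
        = h x y" if "x \<in> carrier V" "y \<in> carrier V" for x y
      using D.q_form[OF p p, OF that] that by (simp add: associated_map_def quotient_space_simps)
    fix w assume "w \<in> carrier (completion_space (quotient_space V h))"
    then obtain \<sigma> where \<sigma>: "\<And>n. \<sigma> n \<in> carrier (quotient_space V h)"
      "D.W.conv (\<lambda>n. cauchy_rel (quotient_space V h) `` {\<lambda>m. \<sigma> n}) w"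
      using D.q_dense by blast
    from \<sigma>(1) have "\<forall>n. \<exists>x\<in>carrier V. \<sigma> n = null_space V h +> x"
      by (auto simp: quotient_space_simps(1))
    then obtain x where x: "\<And>n. x n \<in> carrier V" "\<And>n. \<sigma> n = null_space V h +> x n" by metis
    then have "D.W.conv (\<lambda>n. associated_map V h (x n)) w"
      using \<sigma>(2) by (simp add: associated_map_def)
    with x show "\<exists>\<sigma>. (\<forall>n. \<sigma> n \<in> carrier V) \<and> D.W.conv (\<lambda>n. associated_map V h (\<sigma> n)) w" by blast
  qed
qed

end

section \<open>Bounded operators and adjoints\<close>

lemma (in psd_space) additive_diff:
  assumes "\<And>x. x \<in> carrier V \<Longrightarrow> T x \<in> carrier V"
    and "\<And>x y. x \<in> carrier V \<Longrightarrow> y \<in> carrier V \<Longrightarrow> T (x \<oplus> y) = T x \<oplus> T y"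
    and "x \<in> carrier V" "y \<in> carrier V"
  shows "T (x \<ominus> y) = T x \<ominus> T y"
proof -
  have "T (x \<ominus> y) \<oplus> T y = (T x \<ominus> T y) \<oplus> T y"
    using assms(2)[of "x \<ominus> y" y] assms by simp
  then show ?thesis
    using M.add.right_cancel[THEN iffD1, of "T y" "T (x \<ominus> y)" "T x \<ominus> T y"] assms by simp
qed

context inner_space
begin

lemma bounded_operatorsI:
  assumes "A \<in> extensional (carrier V)"
    and "\<And>x. x \<in> carrier V \<Longrightarrow> A x \<in> carrier V"
    and "\<And>x y. x \<in> carrier V \<Longrightarrow> y \<in> carrier V \<Longrightarrow> A (x \<oplus> y) = A x \<oplus> A y"
    and "\<And>c x. x \<in> carrier V \<Longrightarrow> A (c \<odot> x) = c \<odot> A x"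
    and "\<And>x. x \<in> carrier V \<Longrightarrow> nrm (A x) \<le> C * nrm x"
  shows "A \<in> bounded_operators V"
  unfolding bounded_operators_def cnorm_eq_nrm using assms by (auto simp: PiE_def intro!: exI[of _ C])

context
  fixes A assumes A: "A \<in> bounded_operators V"
begin

lemma bop_closed: "x \<in> carrier V \<Longrightarrow> A x \<in> carrier V"
  using A by (auto simp: bounded_operators_def)

lemma bop_add: "x \<in> carrier V \<Longrightarrow> y \<in> carrier V \<Longrightarrow> A (x \<oplus> y) = A x \<oplus> A y"
  using A by (auto simp: bounded_operators_def)

lemma bop_smult: "x \<in> carrier V \<Longrightarrow> A (c \<odot> x) = c \<odot> A x"
  using A by (auto simp: bounded_operators_def)

lemma bop_extensional: "A \<in> extensional (carrier V)"
  using A by (auto simp: bounded_operators_def PiE_def)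

lemma bop_bound: obtains C where "C > 0" "\<And>x. x \<in> carrier V \<Longrightarrow> nrm (A x) \<le> C * nrm x"
proof -
  obtain C where C: "\<And>x. x \<in> carrier V \<Longrightarrow> nrm (A x) \<le> C * nrm x"
    using A unfolding bounded_operators_def cnorm_eq_nrm by blast
  \<comment> \<open>The constant in the definition may be negative or 0. The maximum with 1 makes it
    positive, as the later divisions and square roots require.\<close>
  have "nrm (A x) \<le> max C 1 * nrm x" if "x \<in> carrier V" for x
    using C[OF that] mult_right_mono[of C "max C 1" "nrm x"] that by simp
  then show thesis by (intro that[of "max C 1"]) auto
qed

lemma bop_diff: "x \<in> carrier V \<Longrightarrow> y \<in> carrier V \<Longrightarrow> A (x \<ominus> y) = A x \<ominus> A y"
  by (rule additive_diff[OF bop_closed bop_add])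

lemma bop_conv:
  assumes "conv \<sigma> x"
  shows "conv (\<lambda>n. A (\<sigma> n)) (A x)"
proof -
  obtain C where C: "\<And>x. x \<in> carrier V \<Longrightarrow> nrm (A x) \<le> C * nrm x" using bop_bound by blast
  show ?thesis
  proof (rule convI_bound)
    show "(\<lambda>n. C * nrm (\<sigma> n \<ominus> x)) \<longlonglongrightarrow> 0"
      by (rule tendsto_mult_right_zero[OF conv_dist[OF assms]])
    show "nrm (A (\<sigma> n) \<ominus> A x) \<le> C * nrm (\<sigma> n \<ominus> x)" for n
      using C[of "\<sigma> n \<ominus> x"] convD[OF assms] by (simp add: bop_diff)
  qed (use convD[OF assms] bop_closed in auto)
qed

end

lemma bop_compose:
  assumes A: "A \<in> bounded_operators V" and B: "B \<in> bounded_operators V"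
  shows "compose (carrier V) A B \<in> bounded_operators V"
proof -
  obtain C where C: "C > 0" "\<And>x. x \<in> carrier V \<Longrightarrow> nrm (A x) \<le> C * nrm x"
    using bop_bound[OF A] by blast
  obtain D where D: "\<And>x. x \<in> carrier V \<Longrightarrow> nrm (B x) \<le> D * nrm x"
    using bop_bound[OF B] by blast
  show ?thesis
  proof (rule bounded_operatorsI[where C = "C * D"])
    show "nrm (compose (carrier V) A B x) \<le> C * D * nrm x" if x: "x \<in> carrier V" for x
      using C(2)[OF bop_closed[OF B x]] mult_left_mono[OF D[OF x] less_imp_le[OF C(1)]] x
      by (simp add: compose_eq mult.assoc)
  qed (auto simp: compose_eq bop_closed[OF A] bop_closed[OF B] bop_add[OF A] bop_add[OF B]
      bop_smult[OF A] bop_smult[OF B])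
qed

lemma eq_if_form_eq:
  assumes "a \<in> carrier V" "b \<in> carrier V"
    and "\<And>x. x \<in> carrier V \<Longrightarrow> cinner V x a = cinner V x b"
  shows "a = b"
proof (rule eqI)
  have "cinner V (a \<ominus> b) (a \<ominus> b) = 0"
    using assms(3)[of "a \<ominus> b"] assms(1,2) by (simp add: form_diff_right)
  then show "nrm (a \<ominus> b) = 0" by (simp add: nrm_def)
qed fact+

lemma adjoint_unique:
  assumes "B \<in> bounded_operators V" "B' \<in> bounded_operators V"
    and "\<And>x y. x \<in> carrier V \<Longrightarrow> y \<in> carrier V \<Longrightarrow> cinner V (A x) y = cinner V x (B y)"
    and "\<And>x y. x \<in> carrier V \<Longrightarrow> y \<in> carrier V \<Longrightarrow> cinner V (A x) y = cinner V x (B' y)"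
  shows "B = B'"
proof (rule extensionalityI[OF bop_extensional[OF assms(1)] bop_extensional[OF assms(2)]])
  fix y assume y: "y \<in> carrier V"
  show "B y = B' y"
    by (rule eq_if_form_eq) (use y assms(3,4) bop_closed[OF assms(1)] bop_closed[OF assms(2)] in auto)
qed

text \<open>An operator exhibited as an adjoint is the one described, by uniqueness; no existence
  theorem enters. This identifies the adjoints on the associated space.\<close>

lemma adjoint_operator_eqI:
  assumes "B \<in> bounded_operators V"
    and "\<And>x y. x \<in> carrier V \<Longrightarrow> y \<in> carrier V \<Longrightarrow> cinner V (A x) y = cinner V x (B y)"
  shows "adjoint_operator V A = B"
  unfolding adjoint_operator_def
  by (rule the_equality) (use assms adjoint_unique in \<open>blast+\<close>)

end

section \<open>Riesz representation and existence of adjoints\<close>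

locale hilbert_space = inner_space +
  assumes complete: "cauchy \<sigma> \<Longrightarrow> \<exists>x. conv \<sigma> x"

lemma complex_hilbert_space_iff: "complex_hilbert_space V \<longleftrightarrow> hilbert_space V"
  unfolding complex_hilbert_space_def complex_inner_space_iff hilbert_space_def
    hilbert_space_axioms_def
  using inner_space.mcomplete_iff by blast

context hilbert_space
begin

text \<open>The representing vector minimises \<open>x \<mapsto> \<parallel>x\<parallel>\<^sup>2 - 2 Re f(x)\<close>; a minimising sequence
  is Cauchy by the parallelogram law.\<close>

lemma riesz:
  fixes f :: "'a \<Rightarrow> complex"
  assumes add: "\<And>x y. x \<in> carrier V \<Longrightarrow> y \<in> carrier V \<Longrightarrow> f (x \<oplus> y) = f x + f y"
    and smult: "\<And>c x. x \<in> carrier V \<Longrightarrow> f (c \<odot> x) = c * f x"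
    and bound: "\<And>x. x \<in> carrier V \<Longrightarrow> cmod (f x) \<le> C * nrm x"
  shows "\<exists>z\<in>carrier V. \<forall>x\<in>carrier V. f x = cinner V z x"
proof -
  define Q where "Q x = (nrm x)\<^sup>2 - 2 * Re (f x)" for x
  define m where "m = Inf (Q ` carrier V)"
  \<comment> \<open>Completing the square shows that the functional to be minimised is bounded
    below.\<close>
  have "- C\<^sup>2 \<le> Q x" if x: "x \<in> carrier V" for x
  proof -
    have "Re (f x) \<le> C * nrm x"
      using complex_Re_le_cmod bound[OF x] order_trans by blast
    moreover have "0 \<le> (nrm x - C)\<^sup>2" by simp
    ultimately show ?thesis by (simp add: Q_def power2_eq_square algebra_simps)
  qed
  then have bdd: "bdd_below (Q ` carrier V)" by (intro bdd_belowI2)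
  have m_le: "m \<le> Q x" if "x \<in> carrier V" for x
    unfolding m_def using that bdd by (intro cINF_lower) auto
  have "\<exists>x\<in>carrier V. Q x < m + inverse (real (Suc n))" for n
  proof -
    have "Inf (Q ` carrier V) < m + inverse (real (Suc n))" by (simp add: m_def)
    moreover have "Q ` carrier V \<noteq> {}" using M.zero_closed by blast
    ultimately show ?thesis using cInf_lessD[of "Q ` carrier V"] by blast
  qed
  then obtain \<sigma> where \<sigma>: "\<And>n. \<sigma> n \<in> carrier V" "\<And>n. Q (\<sigma> n) < m + inverse (real (Suc n))"
    by metis
  \<comment> \<open>Parallelogram law for \<open>x\<close> and \<open>y\<close>, using that the
    value at the midpoint \<open>z\<close> is at least \<open>m\<close>.\<close>
  have par: "(nrm (x \<ominus> y))\<^sup>2 \<le> 2 * (Q x - m) + 2 * (Q y - m)"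
    if x: "x \<in> carrier V" and y: "y \<in> carrier V" for x y
  proof -
    define z where "z = (1/2) \<odot> (x \<oplus> y)"
    have "nrm (x \<oplus> y) = 2 * nrm z" using x y by (simp add: z_def nrm_smult)
    then have "4 * (nrm z)\<^sup>2 = (nrm (x \<oplus> y))\<^sup>2" by (simp add: power_mult_distrib)
    moreover have "(nrm (x \<oplus> y))\<^sup>2 = (nrm x)\<^sup>2 + 2 * Re (cinner V x y) + (nrm y)\<^sup>2"
      using nrm_add_smult_sq[OF x y, of 1] y by simp
    moreover have "f z + f z = f x + f y" using x y by (simp add: z_def smult add)
    then have "Re (f z + f z) = Re (f x + f y)" by (rule arg_cong)
    then have "2 * Re (f z) = Re (f x) + Re (f y)" by simp
    moreover have "m \<le> Q z" using x y by (intro m_le) (simp add: z_def)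
    ultimately show ?thesis using nrm_diff_sq[OF x y] by (simp add: Q_def)
  qed
  have "cauchy \<sigma>"
    unfolding cauchy_def
  proof (intro conjI allI impI \<sigma>(1))
    fix \<epsilon> :: real assume "\<epsilon> > 0"
    \<comment> \<open>Values within \<open>\<epsilon>\<^sup>2 / 4\<close> of the infimum make the
      bound in \<open>par\<close> smaller than \<open>\<epsilon>\<^sup>2\<close>.\<close>
    then obtain N where N: "inverse (real (Suc N)) < \<epsilon>\<^sup>2 / 4"
      using reals_Archimedean[of "\<epsilon>\<^sup>2 / 4"] by auto
    have "nrm (\<sigma> k \<ominus> \<sigma> l) < \<epsilon>" if kl: "k \<ge> N" "l \<ge> N" for k l
    proof (rule power2_less_imp_less)
      have "Q (\<sigma> j) - m < \<epsilon>\<^sup>2 / 4" if "j \<ge> N" for j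
      proof -
        have "inverse (real (Suc j)) \<le> inverse (real (Suc N))"
          using that by (intro le_imp_inverse_le) auto
        with N have "inverse (real (Suc j)) < \<epsilon>\<^sup>2 / 4" by (rule le_less_trans[rotated])
        then have "m + inverse (real (Suc j)) < m + \<epsilon>\<^sup>2 / 4" by (rule add_strict_left_mono)
        from order.strict_trans[OF \<sigma>(2) this] show ?thesis by linarith
      qed
      from this[OF kl(1)] this[OF kl(2)]
      have "2 * (Q (\<sigma> k) - m) + 2 * (Q (\<sigma> l) - m) < 2 * (\<epsilon>\<^sup>2 / 4) + 2 * (\<epsilon>\<^sup>2 / 4)"
        by (intro add_strict_mono mult_strict_left_mono) auto
      with par[OF \<sigma>(1) \<sigma>(1), of k l]
      have "(nrm (\<sigma> k \<ominus> \<sigma> l))\<^sup>2 < 2 * (\<epsilon>\<^sup>2 / 4) + 2 * (\<epsilon>\<^sup>2 / 4)"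
        by (rule order_le_less_trans)
      then show "(nrm (\<sigma> k \<ominus> \<sigma> l))\<^sup>2 < \<epsilon>\<^sup>2" by simp
    qed (use \<open>\<epsilon> > 0\<close> in simp)
    then show "\<exists>N. \<forall>k\<ge>N. \<forall>l\<ge>N. nrm (\<sigma> k \<ominus> \<sigma> l) < \<epsilon>" by blast
  qed
  then obtain z where z: "conv \<sigma> z" using complete by blast
  have zV: "z \<in> carrier V" by (rule convD(2)[OF z])
  have "(\<lambda>n. f (\<sigma> n) - f z) \<longlonglongrightarrow> 0"
  proof (rule Lim_null_comparison[OF _ tendsto_mult_right_zero[OF conv_dist[OF z]]])
    have "cmod (f (\<sigma> n) - f z) \<le> C * nrm (\<sigma> n \<ominus> z)" for n
      using bound[of "\<sigma> n \<ominus> z"] add[of "\<sigma> n \<ominus> z" z] \<sigma>(1)[of n] zV by simp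
    then show "\<forall>\<^sub>F n in sequentially. cmod (f (\<sigma> n) - f z) \<le> C * nrm (\<sigma> n \<ominus> z)"
      by (rule always_eventually[OF allI])
  qed
  then have "(\<lambda>n. f (\<sigma> n)) \<longlonglongrightarrow> f z" by (simp add: LIM_zero_iff)
  then have Q_lim: "(\<lambda>n. Q (\<sigma> n)) \<longlonglongrightarrow> Q z"
    unfolding Q_def by (intro tendsto_intros conv_nrm z)
  have "(\<lambda>n. m + inverse (real (Suc n))) \<longlonglongrightarrow> m + 0"
    by (intro tendsto_intros LIMSEQ_inverse_real_of_nat)
  from LIMSEQ_le[OF Q_lim this] have "Q z \<le> m"
    using less_imp_le[OF \<sigma>(2)] by simp
  then have min: "Q z \<le> Q x" if "x \<in> carrier V" for x
    using m_le[OF that] by simp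
  \<comment> \<open>First variation: along the line \<open>z \<oplus> t \<odot> v\<close> with real
    \<open>t\<close>, the minimum at \<open>t = 0\<close> forces the linear coefficient
    \<open>a\<close> to vanish.\<close>
  have Re_eq: "Re (f v) = Re (cinner V z v)" if v: "v \<in> carrier V" for v
  proof -
    define a where "a = Re (cinner V z v) - Re (f v)"
    define b where "b = (nrm v)\<^sup>2"
    have b: "b + 1 > 0" by (simp add: b_def add_nonneg_pos)
    have "0 \<le> 2 * t * a + t\<^sup>2 * b" for t :: real
    proof -
      have "Q (z \<oplus> of_real t \<odot> v) = Q z + 2 * t * a + t\<^sup>2 * b"
        using nrm_add_smult_sq[OF zV v, of "of_real t"] add[of z "of_real t \<odot> v"] smult[of v "of_real t"]
          zV v by (simp add: Q_def a_def b_def algebra_simps)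
      then show ?thesis using min[of "z \<oplus> of_real t \<odot> v"] zV v by simp
    qed
    \<comment> \<open>The quadratic would be minimal at \<open>- a / b\<close>; the denominator
      \<open>b + 1\<close> also covers \<open>b = 0\<close> and still gives the negative value
      \<open>- (t\<^sup>2 * (b + 2))\<close> unless \<open>t = 0\<close>.\<close>
    moreover define t where "t = - a / (b + 1)"
    ultimately have "0 \<le> 2 * t * a + t\<^sup>2 * b" by blast
    moreover have a: "a = - (t * (b + 1))" using b by (simp add: t_def)
    ultimately have "t\<^sup>2 * (b + 2) \<le> 0" by (simp add: power2_eq_square algebra_simps)
    then have "t = 0" using b by (simp add: mult_le_0_iff)
    then have "a = 0" using a by simp
    then show ?thesis by (simp add: a_def)
  qed
  have "f x = cinner V z x" if x: "x \<in> carrier V" for x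
  proof (rule complex_eqI)
    \<comment> \<open>Multiplication by \<open>\<i>\<close> turns the imaginary part into the
      negative of a real part.\<close>
    have "Re (f (\<i> \<odot> x)) = Re (cinner V z (\<i> \<odot> x))" using x by (intro Re_eq) simp
    then show "Im (f x) = Im (cinner V z x)" using x zV by (simp add: smult form_smult_right)
  qed (rule Re_eq[OF x])
  with zV show ?thesis by blast
qed

text \<open>For fixed \<open>y\<close> the functional \<open>x \<mapsto> cinner V y (A x)\<close> is
  linear and bounded, and its Riesz vector is taken as \<open>B y\<close>. Linearity of
  \<open>B\<close> follows since a vector is determined by its scalar products.\<close>

lemma adjoint_exists:
  assumes A: "A \<in> bounded_operators V"
  shows "\<exists>B\<in>bounded_operators V.
    \<forall>x\<in>carrier V. \<forall>y\<in>carrier V. cinner V (A x) y = cinner V x (B y)"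
proof -
  obtain C where C: "C > 0" "\<And>x. x \<in> carrier V \<Longrightarrow> nrm (A x) \<le> C * nrm x"
    using bop_bound[OF A] by blast
  have "\<exists>z\<in>carrier V. \<forall>x\<in>carrier V. cinner V y (A x) = cinner V z x" if y: "y \<in> carrier V" for y
  proof (rule riesz[where C = "nrm y * C"])
    show "cmod (cinner V y (A x)) \<le> nrm y * C * nrm x" if x: "x \<in> carrier V" for x
      using cauchy_schwarz[OF y bop_closed[OF A x]] mult_left_mono[OF C(2)[OF x] nrm_nonneg[OF y]]
      by (simp add: mult.assoc)
  qed (use y in \<open>auto simp: bop_add[OF A] bop_smult[OF A] bop_closed[OF A] form_simps\<close>)
  then obtain B where B: "\<And>y. y \<in> carrier V \<Longrightarrow> B y \<in> carrier V"
    "\<And>x y. x \<in> carrier V \<Longrightarrow> y \<in> carrier V \<Longrightarrow> cinner V y (A x) = cinner V (B y) x" by metis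
  have adj: "cinner V x (B y) = cinner V (A x) y" if "x \<in> carrier V" "y \<in> carrier V" for x y
    using B(2)[OF that] form_herm[of y "A x"] form_herm[of "B y" x] B(1) bop_closed[OF A] that
    by simp
  have "restrict B (carrier V) \<in> bounded_operators V"
  proof (rule bounded_operatorsI[where C = C])
    show "restrict B (carrier V) (x \<oplus> y) = restrict B (carrier V) x \<oplus> restrict B (carrier V) y"
      if "x \<in> carrier V" "y \<in> carrier V" for x y
      using that B(1) bop_closed[OF A] by (simp, intro eq_if_form_eq) (simp_all add: adj form_add_right)
    show "restrict B (carrier V) (c \<odot> x) = c \<odot> restrict B (carrier V) x"
      if "x \<in> carrier V" for c x
      using that B(1) bop_closed[OF A] by (simp, intro eq_if_form_eq) (simp_all add: adj form_smult_right)
    show "nrm (restrict B (carrier V) y) \<le> C * nrm y" if y: "y \<in> carrier V" for y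
    \<comment> \<open>The estimate bounds the square of \<open>nrm (B y)\<close> by
      \<open>C * nrm (B y) * nrm y\<close>; one factor can be cancelled only if it is
      nonzero.\<close>
    proof (cases "nrm (B y) = 0")
      case False
      have "cinner V (A (B y)) y = of_real ((nrm (B y))\<^sup>2)"
        using adj[OF B(1)[OF y] y] form_nrm[OF B(1)[OF y]] by simp
      then have "(nrm (B y))\<^sup>2 = cmod (cinner V (A (B y)) y)"
        by (simp only: norm_of_real abs_power2)
      also have "\<dots> \<le> nrm (A (B y)) * nrm y"
        by (intro cauchy_schwarz bop_closed[OF A] B(1) y)
      also have "\<dots> \<le> C * nrm (B y) * nrm y"
        by (intro mult_right_mono C(2) B(1) y nrm_nonneg)
      finally have "nrm (B y) * nrm (B y) \<le> nrm (B y) * (C * nrm y)"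
        by (simp add: power2_eq_square mult_ac)
      then have "nrm (B y) \<le> C * nrm y"
        using False nrm_nonneg[OF B(1)[OF y]] by (simp add: mult_le_cancel_left)
      with y show ?thesis by simp
    qed (use y C(1) in simp)
  qed (auto simp: B(1))
  with adj show ?thesis by (intro bexI[of _ "restrict B (carrier V)"]) auto
qed

lemma adjoint_operator:
  assumes "A \<in> bounded_operators V"
  shows "adjoint_operator V A \<in> bounded_operators V"
    and "x \<in> carrier V \<Longrightarrow> y \<in> carrier V \<Longrightarrow>
      cinner V (A x) y = cinner V x (adjoint_operator V A y)"
proof -
  obtain B where B: "B \<in> bounded_operators V"
    "\<And>x y. x \<in> carrier V \<Longrightarrow> y \<in> carrier V \<Longrightarrow> cinner V (A x) y = cinner V x (B y)"
    using adjoint_exists[OF assms] by blast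
  note adjoint_operator_eqI[OF B]
  with B show "adjoint_operator V A \<in> bounded_operators V"
    "x \<in> carrier V \<Longrightarrow> y \<in> carrier V \<Longrightarrow> cinner V (A x) y = cinner V x (adjoint_operator V A y)"
    by auto
qed

end

section \<open>Identities and extensions from a dense subspace\<close>

context dense_isometry
begin

lemma bop_eq_if_eq_on_dense:
  assumes A: "A \<in> bounded_operators W" and B: "B \<in> bounded_operators W"
    and eq: "\<And>x. x \<in> carrier V \<Longrightarrow> A (q x) = B (q x)"
  shows "A = B"
proof (rule extensionalityI[OF W.bop_extensional[OF A] W.bop_extensional[OF B]])
  fix w assume "w \<in> carrier W"
  then obtain \<sigma> where \<sigma>: "\<And>n. \<sigma> n \<in> carrier V" "W.conv (\<lambda>n. q (\<sigma> n)) w" using q_dense by blast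
  show "A w = B w"
    using W.bop_conv[OF A \<sigma>(2)] W.bop_conv[OF B \<sigma>(2)] by (simp add: eq \<sigma>(1) W.conv_unique)
qed

lemma form_eq_if_eq_on_dense:
  assumes A: "A \<in> bounded_operators W" and B: "B \<in> bounded_operators W"
    and eq: "\<And>x y. x \<in> carrier V \<Longrightarrow> y \<in> carrier V \<Longrightarrow>
      cinner W (A (q x)) (q y) = cinner W (q x) (B (q y))"
    and v: "v \<in> carrier W" and w: "w \<in> carrier W"
  shows "cinner W (A v) w = cinner W v (B w)"
proof -
  obtain \<sigma> where \<sigma>: "\<And>n. \<sigma> n \<in> carrier V" "W.conv (\<lambda>n. q (\<sigma> n)) v" using q_dense v by blast
  obtain \<tau> where \<tau>: "\<And>n. \<tau> n \<in> carrier V" "W.conv (\<lambda>n. q (\<tau> n)) w" using q_dense w by blast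
  show ?thesis
    using W.conv_form[OF W.bop_conv[OF A \<sigma>(2)] \<tau>(2)] W.conv_form[OF \<sigma>(2) W.bop_conv[OF B \<tau>(2)]]
    by (simp add: eq \<sigma>(1) \<tau>(1) LIMSEQ_unique)
qed

text \<open>The value at \<open>w\<close> is the common limit of \<open>q (T (\<sigma> n))\<close>
  over all sequences with \<open>q (\<sigma> n)\<close> tending to \<open>w\<close>. Sums and
  multiples of such sequences approximate sums and multiples of \<open>w\<close>, which makes the
  extension linear.\<close>

lemma extension:
  assumes complete: "\<And>\<sigma>. W.cauchy \<sigma> \<Longrightarrow> \<exists>w. W.conv \<sigma> w"
    and closed: "\<And>x. x \<in> carrier V \<Longrightarrow> T x \<in> carrier V"
    and add: "\<And>x y. x \<in> carrier V \<Longrightarrow> y \<in> carrier V \<Longrightarrow> T (x \<oplus> y) = T x \<oplus> T y"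
    and smult: "\<And>c x. x \<in> carrier V \<Longrightarrow> T (c \<odot> x) = c \<odot> T x"
    and bound: "\<And>x. x \<in> carrier V \<Longrightarrow> nrm (T x) \<le> C * nrm x" and C: "C > 0"
  shows "\<exists>A\<in>bounded_operators W. \<forall>x\<in>carrier V. A (q x) = q (T x)"
proof -
  \<comment> \<open>In particular \<open>q (T x)\<close> depends only on \<open>q x\<close>, even
    when \<open>q\<close> is not injective.\<close>
  have T_dist: "W.nrm (q (T x) \<ominus>\<^bsub>W\<^esub> q (T y)) \<le> C * W.nrm (q x \<ominus>\<^bsub>W\<^esub> q y)"
    if "x \<in> carrier V" "y \<in> carrier V" for x y
    using bound[of "x \<ominus> y"] additive_diff[of T, OF closed add] that by (simp add: q_dist closed)
  \<comment> \<open>Quantifying over all approximating sequences inside the existential makes the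
    chosen value independent of the sequence.\<close>
  have "\<exists>v. \<forall>\<sigma>. (\<forall>n. \<sigma> n \<in> carrier V) \<longrightarrow> W.conv (\<lambda>n. q (\<sigma> n)) w \<longrightarrow>
      W.conv (\<lambda>n. q (T (\<sigma> n))) v" if w: "w \<in> carrier W" for w
  proof -
    obtain \<tau> where \<tau>: "\<And>n. \<tau> n \<in> carrier V" "W.conv (\<lambda>n. q (\<tau> n)) w" using q_dense w by blast
    have "W.cauchy (\<lambda>n. q (T (\<tau> n)))"
      unfolding W.cauchy_def
    proof (intro conjI allI impI q_closed closed \<tau>(1))
      fix \<epsilon> :: real assume "\<epsilon> > 0"
      then have "\<epsilon> / C > 0" using C by simp
      then obtain N where N: "\<And>m n. m \<ge> N \<Longrightarrow> n \<ge> N \<Longrightarrow> W.nrm (q (\<tau> m) \<ominus>\<^bsub>W\<^esub> q (\<tau> n)) < \<epsilon> / C"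
        using W.conv_imp_cauchy[OF \<tau>(2)] unfolding W.cauchy_def by meson
      have "W.nrm (q (T (\<tau> m)) \<ominus>\<^bsub>W\<^esub> q (T (\<tau> n))) < \<epsilon>" if "m \<ge> N" "n \<ge> N" for m n
        using N[OF that] T_dist[OF \<tau>(1) \<tau>(1), of m n] C by (simp add: pos_less_divide_eq mult.commute)
      then show "\<exists>N. \<forall>m\<ge>N. \<forall>n\<ge>N. W.nrm (q (T (\<tau> m)) \<ominus>\<^bsub>W\<^esub> q (T (\<tau> n))) < \<epsilon>" by blast
    qed
    then obtain v where v: "W.conv (\<lambda>n. q (T (\<tau> n))) v" using complete by blast
    have "W.conv (\<lambda>n. q (T (\<sigma> n))) v"
      if \<sigma>: "\<forall>n. \<sigma> n \<in> carrier V" "W.conv (\<lambda>n. q (\<sigma> n)) w" for \<sigma>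
    proof (rule W.convI_bound)
      have "(\<lambda>n. C * (W.nrm (q (\<sigma> n) \<ominus>\<^bsub>W\<^esub> w) + W.nrm (q (\<tau> n) \<ominus>\<^bsub>W\<^esub> w)) +
          W.nrm (q (T (\<tau> n)) \<ominus>\<^bsub>W\<^esub> v)) \<longlonglongrightarrow> C * (0 + 0) + 0"
        by (intro tendsto_add tendsto_mult tendsto_const W.conv_dist \<sigma>(2) \<tau>(2) v)
      then show "(\<lambda>n. C * (W.nrm (q (\<sigma> n) \<ominus>\<^bsub>W\<^esub> w) + W.nrm (q (\<tau> n) \<ominus>\<^bsub>W\<^esub> w)) +
          W.nrm (q (T (\<tau> n)) \<ominus>\<^bsub>W\<^esub> v)) \<longlonglongrightarrow> 0" by simp
      fix n
      have 1: "W.nrm (q (\<sigma> n) \<ominus>\<^bsub>W\<^esub> q (\<tau> n)) \<le> W.nrm (q (\<sigma> n) \<ominus>\<^bsub>W\<^esub> w) + W.nrm (q (\<tau> n) \<ominus>\<^bsub>W\<^esub> w)"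
        using W.dist_triangle[of "q (\<sigma> n)" w "q (\<tau> n)"] W.nrm_diff_commute[of w "q (\<tau> n)"] \<sigma> \<tau> w
        by simp
      have "W.nrm (q (T (\<sigma> n)) \<ominus>\<^bsub>W\<^esub> v) \<le>
          W.nrm (q (T (\<sigma> n)) \<ominus>\<^bsub>W\<^esub> q (T (\<tau> n))) + W.nrm (q (T (\<tau> n)) \<ominus>\<^bsub>W\<^esub> v)"
        using \<sigma> \<tau> closed W.convD(2)[OF v] by (intro W.dist_triangle) auto
      also have "\<dots> \<le> C * W.nrm (q (\<sigma> n) \<ominus>\<^bsub>W\<^esub> q (\<tau> n)) + W.nrm (q (T (\<tau> n)) \<ominus>\<^bsub>W\<^esub> v)"
        using T_dist \<sigma> \<tau> by simp
      also have "\<dots> \<le> C * (W.nrm (q (\<sigma> n) \<ominus>\<^bsub>W\<^esub> w) + W.nrm (q (\<tau> n) \<ominus>\<^bsub>W\<^esub> w)) +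
          W.nrm (q (T (\<tau> n)) \<ominus>\<^bsub>W\<^esub> v)"
        using mult_left_mono[OF 1 less_imp_le[OF C]] by simp
      finally show "W.nrm (q (T (\<sigma> n)) \<ominus>\<^bsub>W\<^esub> v) \<le> \<dots>" .
    qed (use \<sigma> closed W.convD(2)[OF v] in auto)
    then show ?thesis by blast
  qed
  then obtain A where A: "\<And>w \<sigma>. w \<in> carrier W \<Longrightarrow> (\<And>n. \<sigma> n \<in> carrier V) \<Longrightarrow>
      W.conv (\<lambda>n. q (\<sigma> n)) w \<Longrightarrow> W.conv (\<lambda>n. q (T (\<sigma> n))) (A w)" by metis
  have approx: "\<exists>\<sigma>. (\<forall>n. \<sigma> n \<in> carrier V) \<and> W.conv (\<lambda>n. q (\<sigma> n)) w \<and>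
      W.conv (\<lambda>n. q (T (\<sigma> n))) (A w)" if "w \<in> carrier W" for w
    using q_dense[OF that] A[OF that] by blast
  have A_closed: "A w \<in> carrier W" if "w \<in> carrier W" for w
    using approx[OF that] W.convD(2) by blast
  have A_add: "A (v \<oplus>\<^bsub>W\<^esub> w) = A v \<oplus>\<^bsub>W\<^esub> A w" if v: "v \<in> carrier W" and w: "w \<in> carrier W" for v w
  proof -
    obtain \<sigma> where \<sigma>: "\<And>n. \<sigma> n \<in> carrier V" "W.conv (\<lambda>n. q (\<sigma> n)) v"
      "W.conv (\<lambda>n. q (T (\<sigma> n))) (A v)" using approx[OF v] by blast
    obtain \<tau> where \<tau>: "\<And>n. \<tau> n \<in> carrier V" "W.conv (\<lambda>n. q (\<tau> n)) w"
      "W.conv (\<lambda>n. q (T (\<tau> n))) (A w)" using approx[OF w] by blast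
    have "W.conv (\<lambda>n. q (T (\<sigma> n \<oplus> \<tau> n))) (A (v \<oplus>\<^bsub>W\<^esub> w))"
      using W.conv_add[OF \<sigma>(2) \<tau>(2)] v w by (intro A) (simp_all add: q_add \<sigma>(1) \<tau>(1))
    moreover have "W.conv (\<lambda>n. q (T (\<sigma> n \<oplus> \<tau> n))) (A v \<oplus>\<^bsub>W\<^esub> A w)"
      using W.conv_add[OF \<sigma>(3) \<tau>(3)] by (simp add: q_add add closed \<sigma>(1) \<tau>(1))
    ultimately show ?thesis by (rule W.conv_unique)
  qed
  have A_smult: "A (c \<odot>\<^bsub>W\<^esub> w) = c \<odot>\<^bsub>W\<^esub> A w" if w: "w \<in> carrier W" for c w
  proof -
    obtain \<sigma> where \<sigma>: "\<And>n. \<sigma> n \<in> carrier V" "W.conv (\<lambda>n. q (\<sigma> n)) w"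
      "W.conv (\<lambda>n. q (T (\<sigma> n))) (A w)" using approx[OF w] by blast
    have "W.conv (\<lambda>n. q (T (c \<odot> \<sigma> n))) (A (c \<odot>\<^bsub>W\<^esub> w))"
      using W.conv_smult[OF \<sigma>(2), of c] w by (intro A) (simp_all add: q_smult \<sigma>(1))
    moreover have "W.conv (\<lambda>n. q (T (c \<odot> \<sigma> n))) (c \<odot>\<^bsub>W\<^esub> A w)"
      using W.conv_smult[OF \<sigma>(3), of c] by (simp add: q_smult smult closed \<sigma>(1))
    ultimately show ?thesis by (rule W.conv_unique)
  qed
  have A_bound: "W.nrm (A w) \<le> C * W.nrm w" if w: "w \<in> carrier W" for w
  proof -
    obtain \<sigma> where \<sigma>: "\<And>n. \<sigma> n \<in> carrier V" "W.conv (\<lambda>n. q (\<sigma> n)) w"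
      "W.conv (\<lambda>n. q (T (\<sigma> n))) (A w)" using approx[OF w] by blast
    show ?thesis
      by (rule LIMSEQ_le[OF W.conv_nrm[OF \<sigma>(3)] tendsto_mult_left[OF W.conv_nrm[OF \<sigma>(2)]]])
         (simp add: q_nrm \<sigma>(1) closed bound)
  qed
  have "A (q x) = q (T x)" if "x \<in> carrier V" for x
    using A[of "q x" "\<lambda>n. x"] W.conv_const[of "q x"] W.conv_const[of "q (T x)"] that closed
      W.conv_unique by simp
  moreover have "restrict A (carrier W) \<in> bounded_operators W"
    by (rule W.bounded_operatorsI[where C = C]) (auto simp: A_closed A_add A_smult A_bound)
  ultimately show ?thesis by (intro bexI[of _ "restrict A (carrier W)"]) auto
qed

end

section \<open>Boundedness of symmetric operators\<close>

text \<open>By log-convexity the quotients of successive terms do not decrease. A first quotient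
  \<open>r\<close> above \<open>C\<close> would force growth at least like \<open>r ^ n\<close>,
  beating \<open>K * C ^ n\<close> for every \<open>K\<close>.\<close>

lemma log_convex_seq_le:
  fixes a :: "nat \<Rightarrow> real"
  assumes nonneg: "\<And>n. 0 \<le> a n"
    and convex: "\<And>n. (a (Suc n))\<^sup>2 \<le> a n * a (Suc (Suc n))"
    and growth: "\<And>n. a n \<le> K * C ^ n" and C: "C > 0"
  shows "a 1 \<le> C * a 0"
proof (rule ccontr)
  assume "\<not> a 1 \<le> C * a 0"
  then have less: "C * a 0 < a 1" by simp
  then have a1: "a 1 > 0" using nonneg[of 0] C by (smt (verit) mult_nonneg_nonneg)
  \<comment> \<open>If \<open>a 0\<close> were 0, convexity at index 0 would force
    \<open>a 1 = 0\<close>.\<close>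
  have a0: "a 0 > 0"
  proof (rule ccontr)
    assume "\<not> a 0 > 0"
    then have "a 0 = 0" using nonneg[of 0] by simp
    with convex[of 0] a1 show False by simp
  qed
  define r where "r = a 1 / a 0"
  have r: "r > C" using less a0 by (simp add: r_def field_simps)
  \<comment> \<open>Positivity is carried through the induction because the convexity inequality is
    divided by \<open>a n\<close>.\<close>
  have step: "a n > 0 \<and> r * a n \<le> a (Suc n)" for n
  proof (induction n)
    case 0
    show ?case using a0 by (simp add: r_def)
  next
    case (Suc n)
    have pos: "a (Suc n) > 0"
      using Suc r C by (smt (verit) mult_pos_pos)
    have "a n * (r * a (Suc n)) \<le> (a (Suc n))\<^sup>2"
      using mult_right_mono[of "r * a n" "a (Suc n)" "a (Suc n)"] Suc pos
      by (simp add: power2_eq_square mult_ac)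
    also have "\<dots> \<le> a n * a (Suc (Suc n))" by (rule convex)
    finally show ?case using Suc pos by simp
  qed
  have lower: "r ^ n * a 0 \<le> a n" for n
  proof (induction n)
    case (Suc n)
    have "r ^ Suc n * a 0 \<le> r * a n"
      using mult_left_mono[OF Suc, of r] r C by (simp add: mult.assoc)
    then show ?case using step[of n] by simp
  qed simp
  have bounded: "(r / C) ^ n \<le> K / a 0" for n
    using order_trans[OF lower growth, of n] C a0 by (simp add: power_divide field_simps)
  have "r / C > 1" using r C by simp
  then obtain n where "K / a 0 < (r / C) ^ n" using real_arch_pow by blast
  with bounded[of n] show False by simp
qed

context psd_space
begin

text \<open>The growth condition concerns the single vector \<open>x\<close>, so \<open>K\<close>
  may depend on \<open>x\<close>; only the rate \<open>C\<close> reaches the conclusion.\<close>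

lemma nrm_symmetric_le:
  assumes closed: "\<And>x. x \<in> carrier V \<Longrightarrow> T x \<in> carrier V"
    and symm: "\<And>x y. x \<in> carrier V \<Longrightarrow> y \<in> carrier V \<Longrightarrow> h (T x) y = h x (T y)"
    and growth: "\<And>n. nrm ((T ^^ n) x) \<le> K * C ^ n" and C: "C > 0"
    and x: "x \<in> carrier V"
  shows "nrm (T x) \<le> C * nrm x"
proof -
  have pow: "(T ^^ n) x \<in> carrier V" for n
    by (induction n) (auto simp: x closed)
  have "(nrm ((T ^^ Suc n) x))\<^sup>2 \<le> nrm ((T ^^ n) x) * nrm ((T ^^ Suc (Suc n)) x)" for n
  proof -
    \<comment> \<open>Symmetry moves one factor \<open>T\<close> from the left argument to the right
      one, turning the exponents \<open>n + 1\<close>, \<open>n + 1\<close> into \<open>n\<close>,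
      \<open>n + 2\<close>.\<close>
    have "(nrm ((T ^^ Suc n) x))\<^sup>2 = Re (h ((T ^^ n) x) ((T ^^ Suc (Suc n)) x))"
      using symm[OF pow pow, of n "Suc n"] nrm_sq[OF pow, of "Suc n"] by simp
    also have "\<dots> \<le> nrm ((T ^^ n) x) * nrm ((T ^^ Suc (Suc n)) x)"
      using complex_Re_le_cmod cauchy_schwarz[OF pow pow] order_trans by blast
    finally show ?thesis .
  qed
  from log_convex_seq_le[of "\<lambda>n. nrm ((T ^^ n) x)", OF _ this growth C] pow
  show ?thesis by simp
qed

end

section \<open>The form defined by a positive operator\<close>

context inner_space
begin

text \<open>Positivity is given only as nonnegativity of the values \<open>cinner V x (H x)\<close>.
  Hermitian symmetry is recovered by polarisation, since these values are real.\<close>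

lemma psd_hankel_form:
  assumes "positive_operator V H"
  shows "psd_hermitian_form V (hankel_form V H)"
proof -
  have H: "H \<in> bounded_operators V"
    and pos: "\<And>x. x \<in> carrier V \<Longrightarrow> cinner V x (H x) \<in> \<real>\<^sub>\<ge>\<^sub>0"
    using assms by (auto simp: positive_operator_def)
  note Hs = bop_closed[OF H] bop_add[OF H] bop_smult[OF H]
  have real: "Im (cinner V x (H x)) = 0" if "x \<in> carrier V" for x
    using pos[OF that] by (simp add: complex_nonneg_Reals_iff)
  have herm: "cinner V y (H x) = cnj (cinner V x (H y))"
    if x: "x \<in> carrier V" and y: "y \<in> carrier V" for x y
  proof (rule complex_eqI)
    show "Im (cinner V y (H x)) = Im (cnj (cinner V x (H y)))"
      using real[of "x \<oplus> y"] real[OF x] real[OF y] x y by (simp add: Hs form_simps)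
    \<comment> \<open>The vector \<open>x \<oplus> y\<close> controls the imaginary parts; replacing
      \<open>y\<close> by \<open>\<i> \<odot> y\<close> turns the mixed terms so that real parts
      appear.\<close>
    show "Re (cinner V y (H x)) = Re (cnj (cinner V x (H y)))"
      using real[of "x \<oplus> \<i> \<odot> y"] real[OF x] real[OF y] x y by (simp add: Hs form_simps)
  qed
  show ?thesis
    unfolding psd_hermitian_form_def hankel_form_def
    by (intro conjI ballI allI) (simp add: Hs form_simps, simp add: Hs form_simps, rule herm, auto intro: pos)
qed

end

theorem proposition1p8:
  fixes sharp :: "'s::semigroup_mult \<Rightarrow> 's"
    and F :: "'f hspace"
    and U :: "'s \<Rightarrow> 'f \<Rightarrow> 'f"
    and H :: "'f \<Rightarrow> 'f"
  assumes "involutive_semigroup sharp"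
    and "complex_hilbert_space F"
    and "semigroup_representation F U"
    and "positive_operator F H"
    and "hankel_operator sharp F U H"
  shows "psd_hermitian_form F (hankel_form F H) \<and>
    complex_hilbert_space (associated_space F (hankel_form F H)) \<and>
    (\<exists>!Uhat. star_representation sharp (associated_space F (hankel_form F H)) Uhat \<and>
      (\<forall>s. compose (carrier F) (Uhat s) (associated_map F (hankel_form F H)) =
           compose (carrier F) (associated_map F (hankel_form F H)) (U s)))"
proof -
  interpret F: hilbert_space F
    using assms(2) by (simp add: complex_hilbert_space_iff)
  define h where "h = hankel_form F H"
  have psd: "psd_hermitian_form F h"
    unfolding h_def using assms(4) by (rule F.psd_hankel_form)
  interpret h: psd_space F h
    by (intro psd_space.intro psd_space_axioms.intro psd F.module_axioms)
  define W where "W = associated_space F h"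
  define q where "q = associated_map F h"
  have hilbert: "complex_hilbert_space W"
    unfolding W_def by (rule h.complex_hilbert_space_associated)
  interpret D: dense_isometry F h W q
    unfolding W_def q_def by (rule h.dense_isometry_associated)
  interpret W: hilbert_space W
    using hilbert by (simp add: complex_hilbert_space_iff)

  have sharp: "sharp (sharp s) = s" "sharp (s * t) = sharp t * sharp s" for s t
    using assms(1) by (auto simp: involutive_semigroup_def)
  have U: "U s \<in> bounded_operators F" for s
    using assms(3) by (simp add: semigroup_representation_def)
  have U_mult: "U (s * t) x = U s (U t x)" if "x \<in> carrier F" for s t x
    using assms(3) that by (simp add: semigroup_representation_def compose_eq)
  note U_closed = F.bop_closed[OF U]
  have H: "H \<in> bounded_operators F"
    using assms(4) by (simp add: positive_operator_def)
  have hankel: "H (U s x) = adjoint_operator F (U (sharp s)) (H x)" if "x \<in> carrier F" for s x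
  proof -
    have "compose (carrier F) H (U s) x = compose (carrier F) (adjoint_operator F (U (sharp s))) H x"
      using assms(5) by (simp add: hankel_operator_def)
    with that show ?thesis by (simp add: compose_eq)
  qed
  \<comment> \<open>The Hankel condition is used at \<open>sharp s\<close>, where the adjoint in it
    is that of \<open>U s\<close> because \<open>sharp\<close> is an involution.\<close>
  have U_adj: "h (U s x) y = h x (U (sharp s) y)" if "x \<in> carrier F" "y \<in> carrier F" for s x y
    using hankel[OF that(2), of "sharp s"] F.adjoint_operator(2)[OF U that(1) F.bop_closed[OF H that(2)], of s]
    by (simp add: h_def hankel_form_def sharp)

  obtain K where K: "K > 0" "\<And>x. x \<in> carrier F \<Longrightarrow> F.nrm (H x) \<le> K * F.nrm x"
    using F.bop_bound[OF H] by blast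
  \<comment> \<open>The only link between the seminorm and the norm of \<open>F\<close>;
    \<open>K\<close> is an operator bound of \<open>H\<close>.\<close>
  have h_nrm: "h.nrm x \<le> sqrt K * F.nrm x" if x: "x \<in> carrier F" for x
  proof (rule power2_le_imp_le)
    have "(h.nrm x)\<^sup>2 = Re (cinner F x (H x))"
      using h.nrm_sq[OF x] by (simp add: h_def hankel_form_def)
    also have "\<dots> \<le> F.nrm x * F.nrm (H x)"
      using complex_Re_le_cmod F.cauchy_schwarz[OF x F.bop_closed[OF H x]] order_trans by blast
    also have "\<dots> \<le> F.nrm x * (K * F.nrm x)"
      using x by (intro mult_left_mono K) auto
    also have "\<dots> = (sqrt K * F.nrm x)\<^sup>2"
      using K(1) by (simp add: power_mult_distrib power2_eq_square)
    finally show "(h.nrm x)\<^sup>2 \<le> (sqrt K * F.nrm x)\<^sup>2" .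
  qed (use x K(1) in simp)

  have U_bound: "\<exists>C>0. \<forall>x\<in>carrier F. h.nrm (U s x) \<le> C * h.nrm x" for s
  proof -
    \<comment> \<open>\<open>sharp\<close> fixes \<open>sharp s * s\<close>, so \<open>U_adj\<close>
      makes this operator symmetric for \<open>h\<close>.\<close>
    define T where "T = U (sharp s * s)"
    have T: "T \<in> bounded_operators F" by (simp add: T_def U)
    note T_closed = F.bop_closed[OF T]
    obtain C where C: "C > 0" "\<And>x. x \<in> carrier F \<Longrightarrow> F.nrm (T x) \<le> C * F.nrm x"
      using F.bop_bound[OF T] by blast
    have T_bound: "h.nrm (T x) \<le> C * h.nrm x" if x: "x \<in> carrier F" for x
    \<comment> \<open>The prefactor combines \<open>sqrt K\<close> from \<open>h_nrm\<close> with
      the norm of the vector at which the powers of \<open>T\<close> are evaluated.\<close>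
    proof (rule h.nrm_symmetric_le[where K = "sqrt K * F.nrm x", OF T_closed _ _ C(1) x])
      show "h (T y) z = h y (T z)" if "y \<in> carrier F" "z \<in> carrier F" for y z
        using U_adj[OF that] by (simp add: T_def sharp)
      fix n
      have pow: "(T ^^ n) x \<in> carrier F \<and> F.nrm ((T ^^ n) x) \<le> C ^ n * F.nrm x"
      proof (induction n)
        case (Suc n)
        then have "F.nrm (T ((T ^^ n) x)) \<le> C * (C ^ n * F.nrm x)"
          using C(2)[of "(T ^^ n) x"] mult_left_mono[of _ _ C] C(1) by (meson less_imp_le order_trans)
        with Suc show ?case by (simp add: T_closed mult.assoc)
      qed (use x in simp)
      have "h.nrm ((T ^^ n) x) \<le> sqrt K * F.nrm ((T ^^ n) x)"
        using pow by (intro h_nrm) simp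
      also have "\<dots> \<le> sqrt K * (C ^ n * F.nrm x)"
        using pow K(1) by (intro mult_left_mono) auto
      finally show "h.nrm ((T ^^ n) x) \<le> sqrt K * F.nrm x * C ^ n" by (simp add: mult_ac)
    qed
    have "h.nrm (U s x) \<le> sqrt C * h.nrm x" if x: "x \<in> carrier F" for x
    proof (rule power2_le_imp_le)
      have "(h.nrm (U s x))\<^sup>2 = Re (h x (T x))"
        using h.nrm_sq[OF U_closed[OF x]] U_adj[OF x U_closed[OF x]] by (simp add: T_def U_mult x)
      also have "\<dots> \<le> h.nrm x * h.nrm (T x)"
        using complex_Re_le_cmod h.cauchy_schwarz[OF x T_closed[OF x]] order_trans by blast
      also have "\<dots> \<le> h.nrm x * (C * h.nrm x)"
        using x by (intro mult_left_mono T_bound) auto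
      also have "\<dots> = (sqrt C * h.nrm x)\<^sup>2"
        using C(1) by (simp add: power_mult_distrib power2_eq_square)
      finally show "(h.nrm (U s x))\<^sup>2 \<le> (sqrt C * h.nrm x)\<^sup>2" .
    qed (use x C(1) in simp)
    then show ?thesis using C(1) by (intro exI[of _ "sqrt C"]) simp
  qed

  have "\<exists>A\<in>bounded_operators W. \<forall>x\<in>carrier F. A (q x) = q (U s x)" for s
  proof -
    obtain C where "C > 0" "\<And>x. x \<in> carrier F \<Longrightarrow> h.nrm (U s x) \<le> C * h.nrm x"
      using U_bound by blast
    then show ?thesis
      by (intro D.extension[where C = C] W.complete U_closed F.bop_add[OF U] F.bop_smult[OF U])
  qed
  then obtain Uhat where Uhat: "\<And>s. Uhat s \<in> bounded_operators W"
    "\<And>s x. x \<in> carrier F \<Longrightarrow> Uhat s (q x) = q (U s x)" by metis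
  have "Uhat (s * t) = compose (carrier W) (Uhat s) (Uhat t)" for s t
    by (rule D.bop_eq_if_eq_on_dense[OF Uhat(1) D.W.bop_compose[OF Uhat(1) Uhat(1)]])
       (simp add: Uhat(2) compose_eq U_mult U_closed)
  \<comment> \<open>On the range of \<open>q\<close> the adjoint relation is \<open>U_adj\<close>;
    density carries it to all of \<open>W\<close>.\<close>
  moreover have "Uhat (sharp s) = adjoint_operator W (Uhat s)" for s
    by (rule D.W.adjoint_operator_eqI[symmetric, OF Uhat(1) D.form_eq_if_eq_on_dense[OF Uhat(1) Uhat(1)]])
       (simp_all add: Uhat(2) U_closed D.q_form U_adj)
  ultimately have star: "star_representation sharp W Uhat"
    by (simp add: star_representation_def semigroup_representation_def Uhat(1))
  have inter: "compose (carrier F) (Uhat s) q = compose (carrier F) q (U s)" for s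
    by (simp add: compose_def Uhat(2) cong: restrict_cong)
  have unique: "Uhat' = Uhat"
    if "star_representation sharp W Uhat'"
      "\<forall>s. compose (carrier F) (Uhat' s) q = compose (carrier F) q (U s)" for Uhat'
  \<comment> \<open>The intertwining relation prescribes each operator on the dense range of
    \<open>q\<close>, and a bounded operator is determined by its values there.\<close>
  proof (rule ext, rule D.bop_eq_if_eq_on_dense[OF _ Uhat(1)])
    fix s
    show "Uhat' s \<in> bounded_operators W"
      using that(1) by (simp add: star_representation_def semigroup_representation_def)
    fix x assume x: "x \<in> carrier F"
    have "compose (carrier F) (Uhat' s) q x = compose (carrier F) (Uhat s) q x"
      using that(2) inter by simp
    with x show "Uhat' s (q x) = Uhat s (q x)" by (simp add: compose_eq)
  qed
  show ?thesis
    unfolding h_def[symmetric] W_def[symmetric] q_def[symmetric]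
    using psd hilbert star inter unique by blast
qed

end
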